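(* Let $\nu\in(0,\min\{\lambda/\kappa,\varsigma\})$. Consider the problems $$(P_0):\ \min_{(X,Y)\in\Omega^1\times\Omega^2}F_0(X,Y):=f(XY^{\mathbb T})+\lambda\big(\mathrm{nnzc}(X)+\mathrm{nnzc}(Y)\big),$$ $$(P_R):\ \min_{(X,Y)\in\Omega^1\times\Omega^2}F(X,Y):=f(XY^{\mathbb T})+\lambda\big(\Theta_\nu(X)+\Theta_\nu(Y)\big).$$ Let $\mathcal G_0,\mathcal L_0,\mathcal S_0,\mathcal S^s_0$ denote the sets of global minimizers, local minimizers, stationary points and strong stationary points of $(P_0)$, and $\mathcal G_R,\mathcal L_R,\mathcal S_R,\mathcal S^s_R$ those of $(P_R)$. Then: (i) $\mathcal G_R=\mathcal G_0$ and $\mathcal L_R\subseteq\mathcal L_0$. Moreover, the optimal values of $(P_0)$ and $(P_R)$ are the same. (ii) Every $(X,Y)\in\mathcal G_0$ (or $\mathcal G_R$) has the column consistency property and the column bound-$\nu$ property. (iii) $\mathcal G_0\subseteq\mathcal S^s_0$ and $\mathcal G_R\subseteq\mathcal S^s_R$. Moreover, $\mathcal S^s_0=\mathcal S^s_R\subseteq\mathcal S_R\subseteq\mathcal S_0$.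
   Context: Let $m\ge n\ge1$ and $d\ge1$ be integers, $\lambda>0$, $\varsigma>0$, and let $f:\mathbb R^{m\times n}\to\mathbb R$ be locally Lipschitz continuous. $[d]=\{1,\dots,d\}$. $\|\cdot\|$ is the Euclidean norm of vectors and the spectral norm of matrices. For $C\in\mathbb R^{r\times d}$: $C_i$ is the $i$-th column, $\mathcal I_C:=\{i\in[d]:C_i\ne0\}$, $\mathrm{nnzc}(C):=|\mathcal I_C|$; for $J\subseteq[d]$, $C_J$ is the submatrix of the columns indexed by $J$ (in increasing order), and $\mathcal C_J:=\{Z_J:Z\in\mathcal C\}$ for a set $\mathcal C\subseteq\mathbb R^{r\times d}$ (conditions on an empty set of columns are vacuous). $\Omega^1:=\{X\in\mathbb R^{m\times d}:\|X_i\|\le\varsigma\ \forall i\in[d]\}$, $\Omega^2:=\{Y\in\mathbb R^{n\times d}:\|Y_i\|\le\varsigma\ \forall i\in[d]\}$. $N_{\mathcal S}(Z)$ is the normal cone of convex analysis to a closed convex set $\mathcal S$ at $Z$. $\partial$ denotes the limiting subdifferential: the regular subdifferential $\widehat\partial h(X)$ is the set of $\zeta$ with $\liminf_{Z\to X,Z\ne X}\frac{h(Z)-h(X)-\langle\zeta,Z-X\rangle}{\|Z-X\|_F}\ge0$, and $\zeta\in\partial h(X)$ iff there are $X^k\to X$, $h(X^k)\to h(X)$, $\zeta^k\in\widehat\partial h(X^k)$ with $\zeta^k\to\zeta$ (for convex $h$ it is the convex subdifferential). $\partial_Zf(XY^{\mathbb T}):=\partial f(Z)|_{Z=XY^{\mathbb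 T}}$. The constant $\kappa>0$ is such that $\max\{\|HY_i\|,\|H^{\mathbb T}X_i\|\}\le\kappa$ for all $(X,Y)\in\Omega^1\times\Omega^2$, $H\in\partial_Zf(XY^{\mathbb T})$, $i\in[d]$ (such $\kappa$ exists). For $t\ge0$: $\theta_{\nu,1}(t):=t/\nu$, $\theta_{\nu,2}(t):=1$, $\theta_\nu(t):=\min\{\theta_{\nu,1}(t),\theta_{\nu,2}(t)\}$. For $C\in\mathbb R^{r\times d}$ and $I\in\{1,2\}^d$: $\Theta_\nu(C):=\sum_{i=1}^d\theta_\nu(\|C_i\|)$, $\Theta_{\nu,I}(C):=\sum_{i=1}^d\theta_{\nu,I_i}(\|C_i\|)$. For $C\in\mathbb R^{r\times d}$, $D^C\in\{1,2\}^d$ is $D^C_i:=\max\{j\in\{1,2\}:\theta_{\nu,j}(\|C_i\|)=\theta_\nu(\|C_i\|)\}$. Stationary point of $(P_0)$: $(X,Y)\in\Omega^1\times\Omega^2$ such that for some $H\in\partial_Zf(XY^{\mathbb T})$, with $\mathcal I=\mathcal I_X\cap\mathcal I_Y$, $0\in HY_{\mathcal I}+N_{\Omega^1_{\mathcal I}}(X_{\mathcal I})$ and $0\in H^{\mathbb T}X_{\mathcal I}+N_{\Omega^2_{\mathcal I}}(Y_{\mathcal I})$. Stationary point of $(P_R)$: $(X,Y)\in\Omega^1\times\Omega^2$ such that for some $H\in\partial_Zf(XY^{\mathbb T})$, $0\in HY+\lambda\,\partial\Theta_{\nu,D^X}(X)+N_{\Omega^1}(X)$ and $0\in H^{\mathbb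 T}X+\lambda\,\partial\Theta_{\nu,D^Y}(Y)+N_{\Omega^2}(Y)$ (here $\Theta_{\nu,D^X}$ is differentiated with the index vector $D^X$ held fixed). $(X,Y)$ has the column consistency property if $\mathcal I_X=\mathcal I_Y$, and the column bound-$\nu$ property if $\|X_i\|\notin(0,\nu)$ and $\|Y_i\|\notin(0,\nu)$ for all $i\in[d]$. A strong stationary point of $(P_0)$ (resp. $(P_R)$) is a stationary point of $(P_0)$ (resp. $(P_R)$) having both the column consistency property and the column bound-$\nu$ property. *)

theory Defs
  imports "HOL-Analysis.Analysis"
begin

text \<open>
  An \<open>r \<times> d\<close> matrix is an element of \<open>real ^ 'd ^ 'r\<close>; its \<open>i\<close>-th column is \<open>column i C\<close>.
  The type-class norm and inner product on this type are the Frobenius ones.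
\<close>

definition locally_lipschitz :: "('a::metric_space \<Rightarrow> 'b::metric_space) \<Rightarrow> bool" where
  "locally_lipschitz h \<longleftrightarrow> (\<forall>x. \<exists>u>0. \<exists>L. L-lipschitz_on (ball x u) h)"


subsection \<open>Variational analysis\<close>

definition regular_subdiff :: "('a::euclidean_space \<Rightarrow> real) \<Rightarrow> 'a \<Rightarrow> 'a set" where
  "regular_subdiff h x =
     {\<zeta>. Liminf (at x) (\<lambda>z. ereal ((h z - h x - \<zeta> \<bullet> (z - x)) / norm (z - x))) \<ge> 0}"

definition limiting_subdiff :: "('a::euclidean_space \<Rightarrow> real) \<Rightarrow> 'a \<Rightarrow> 'a set" where
  "limiting_subdiff h x =
     {\<zeta>. \<exists>xs \<zeta>s. xs \<longlonglongrightarrow> x \<and> (\<lambda>k. h (xs k)) \<longlonglongrightarrow> h x \<and>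
           (\<forall>k. \<zeta>s k \<in> regular_subdiff h (xs k)) \<and> \<zeta>s \<longlonglongrightarrow> \<zeta>}"

text \<open>
  Normal cone of convex analysis to \<open>S \<subseteq> E\<close> at \<open>z\<close>, taken inside the linear subspace \<open>E\<close>
  (regarded as the ambient Euclidean space); it is empty for \<open>z \<notin> S\<close>.
\<close>
definition normal_cone_in :: "'a::euclidean_space set \<Rightarrow> 'a set \<Rightarrow> 'a \<Rightarrow> 'a set" where
  "normal_cone_in E S z = {v \<in> E. z \<in> S \<and> (\<forall>w\<in>S. v \<bullet> (w - z) \<le> 0)}"

abbreviation normal_cone :: "'a::euclidean_space set \<Rightarrow> 'a \<Rightarrow> 'a set" where
  "normal_cone \<equiv> normal_cone_in UNIV"

definition global_minimizers :: "('a \<Rightarrow> real) \<Rightarrow> 'a set \<Rightarrow> 'a set" where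
  "global_minimizers F S = {x \<in> S. \<forall>y\<in>S. F x \<le> F y}"

definition local_minimizers :: "('a::metric_space \<Rightarrow> real) \<Rightarrow> 'a set \<Rightarrow> 'a set" where
  "local_minimizers F S = {x \<in> S. \<exists>e>0. \<forall>y \<in> S \<inter> ball x e. F x \<le> F y}"

definition optimal_value :: "('a \<Rightarrow> real) \<Rightarrow> 'a set \<Rightarrow> ereal" where
  "optimal_value F S = (INF x\<in>S. ereal (F x))"


subsection \<open>Columns of matrices\<close>

definition nz_cols :: "real ^ 'd ^ 'r \<Rightarrow> 'd set" where
  "nz_cols C = {i. column i C \<noteq> 0}"

definition nnzc :: "real ^ 'd ^ 'r \<Rightarrow> nat" where
  "nnzc C = card (nz_cols C)"

text \<open>
  The submatrix \<open>C\<^sub>J\<close> is represented by the full-size matrix whose columns outside \<open>J\<close> are zero.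
  Thus \<open>range (cols J)\<close>, with the Frobenius inner product, is an isometric copy of the space of
  \<open>r \<times> |J|\<close> matrices, and normal cones to sets of submatrices are taken inside this subspace.
\<close>
definition cols :: "'d set \<Rightarrow> real ^ 'd ^ 'r \<Rightarrow> real ^ 'd ^ 'r" where
  "cols J C = (\<chi> i j. if j \<in> J then C $ i $ j else 0)"

text \<open>\<open>\<Omega>\<^sup>1\<close> and \<open>\<Omega>\<^sup>2\<close> are the instances with \<open>m\<close> and \<open>n\<close> rows; the bound is \<open>\<sigma> = \<varsigma>\<close>.\<close>
definition Omega :: "real \<Rightarrow> (real ^ 'd ^ 'r) set" where
  "Omega \<sigma> = {C. \<forall>i. norm (column i C) \<le> \<sigma>}"


subsection \<open>The piecewise function \<open>\<theta>\<^sub>\<nu>\<close> and the relaxed column count\<close>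

definition theta_piece :: "real \<Rightarrow> nat \<Rightarrow> real \<Rightarrow> real" where
  "theta_piece \<nu> j t = (if j = 1 then t / \<nu> else 1)"

definition theta :: "real \<Rightarrow> real \<Rightarrow> real" where
  "theta \<nu> t = min (theta_piece \<nu> 1 t) (theta_piece \<nu> 2 t)"

definition Theta :: "real \<Rightarrow> real ^ 'd ^ 'r \<Rightarrow> real" where
  "Theta \<nu> C = (\<Sum>i\<in>UNIV. theta \<nu> (norm (column i C)))"

definition Theta_piece :: "real \<Rightarrow> ('d \<Rightarrow> nat) \<Rightarrow> real ^ 'd ^ 'r \<Rightarrow> real" where
  "Theta_piece \<nu> I C = (\<Sum>i\<in>UNIV. theta_piece \<nu> (I i) (norm (column i C)))"

definition D_index :: "real \<Rightarrow> real ^ 'd ^ 'r \<Rightarrow> 'd \<Rightarrow> nat" where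
  "D_index \<nu> C i =
     Max {j \<in> {1, 2}. theta_piece \<nu> j (norm (column i C)) = theta \<nu> (norm (column i C))}"


subsection \<open>The two problems\<close>

text \<open>Throughout, \<open>l\<close> is the penalty weight \<open>\<lambda>\<close>.\<close>

type_synonym ('m, 'n, 'd) factors = "(real ^ 'd ^ 'm) \<times> (real ^ 'd ^ 'n)"

definition feasible :: "real \<Rightarrow> ('m::finite, 'n::finite, 'd::finite) factors set" where
  "feasible \<sigma> = Omega \<sigma> \<times> Omega \<sigma>"

definition F\<^sub>0 :: "(real ^ 'n ^ 'm \<Rightarrow> real) \<Rightarrow> real \<Rightarrow> ('m::finite, 'n::finite, 'd::finite) factors \<Rightarrow> real"
  where "F\<^sub>0 f l = (\<lambda>(X, Y). f (X ** transpose Y) + l * (real (nnzc X) + real (nnzc Y)))"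

definition F\<^sub>R ::
    "(real ^ 'n ^ 'm \<Rightarrow> real) \<Rightarrow> real \<Rightarrow> real \<Rightarrow> ('m::finite, 'n::finite, 'd::finite) factors \<Rightarrow> real"
  where "F\<^sub>R f l \<nu> = (\<lambda>(X, Y). f (X ** transpose Y) + l * (Theta \<nu> X + Theta \<nu> Y))"

definition G\<^sub>0 ::
    "(real ^ 'n ^ 'm \<Rightarrow> real) \<Rightarrow> real \<Rightarrow> real \<Rightarrow> ('m::finite, 'n::finite, 'd::finite) factors set"
  where "G\<^sub>0 f l \<sigma> = global_minimizers (F\<^sub>0 f l) (feasible \<sigma>)"

definition G\<^sub>R ::
    "(real ^ 'n ^ 'm \<Rightarrow> real) \<Rightarrow> real \<Rightarrow> real \<Rightarrow> real \<Rightarrow> ('m::finite, 'n::finite, 'd::finite) factors set"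
  where "G\<^sub>R f l \<nu> \<sigma> = global_minimizers (F\<^sub>R f l \<nu>) (feasible \<sigma>)"

definition L\<^sub>0 ::
    "(real ^ 'n ^ 'm \<Rightarrow> real) \<Rightarrow> real \<Rightarrow> real \<Rightarrow> ('m::finite, 'n::finite, 'd::finite) factors set"
  where "L\<^sub>0 f l \<sigma> = local_minimizers (F\<^sub>0 f l) (feasible \<sigma>)"

definition L\<^sub>R ::
    "(real ^ 'n ^ 'm \<Rightarrow> real) \<Rightarrow> real \<Rightarrow> real \<Rightarrow> real \<Rightarrow> ('m::finite, 'n::finite, 'd::finite) factors set"
  where "L\<^sub>R f l \<nu> \<sigma> = local_minimizers (F\<^sub>R f l \<nu>) (feasible \<sigma>)"

definition stationary\<^sub>0 ::
    "(real ^ 'n ^ 'm \<Rightarrow> real) \<Rightarrow> real \<Rightarrow> ('m::finite, 'n::finite, 'd::finite) factors set" where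
  "stationary\<^sub>0 f \<sigma> = {(X, Y) \<in> feasible \<sigma>.
     \<exists>H \<in> limiting_subdiff f (X ** transpose Y). let J = nz_cols X \<inter> nz_cols Y in
       0 \<in> {H ** cols J Y + V | V.
              V \<in> normal_cone_in (range (cols J)) (cols J ` Omega \<sigma>) (cols J X)} \<and>
       0 \<in> {transpose H ** cols J X + V | V.
              V \<in> normal_cone_in (range (cols J)) (cols J ` Omega \<sigma>) (cols J Y)}}"

definition stationary\<^sub>R ::
    "(real ^ 'n ^ 'm \<Rightarrow> real) \<Rightarrow> real \<Rightarrow> real \<Rightarrow> real \<Rightarrow> ('m::finite, 'n::finite, 'd::finite) factors set"
  where
  "stationary\<^sub>R f l \<nu> \<sigma> = {(X, Y) \<in> feasible \<sigma>.
     \<exists>H \<in> limiting_subdiff f (X ** transpose Y).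
       0 \<in> {H ** Y + l *\<^sub>R U + V | U V.
              U \<in> limiting_subdiff (Theta_piece \<nu> (D_index \<nu> X)) X \<and>
              V \<in> normal_cone (Omega \<sigma>) X} \<and>
       0 \<in> {transpose H ** X + l *\<^sub>R U + V | U V.
              U \<in> limiting_subdiff (Theta_piece \<nu> (D_index \<nu> Y)) Y \<and>
              V \<in> normal_cone (Omega \<sigma>) Y}}"

definition column_consistent :: "real ^ 'd ^ 'm \<Rightarrow> real ^ 'd ^ 'n \<Rightarrow> bool" where
  "column_consistent X Y \<longleftrightarrow> nz_cols X = nz_cols Y"

definition column_bound :: "real \<Rightarrow> real ^ 'd ^ 'm \<Rightarrow> real ^ 'd ^ 'n \<Rightarrow> bool" where
  "column_bound \<nu> X Y \<longleftrightarrow>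
     (\<forall>i. norm (column i X) \<notin> {0<..<\<nu>} \<and> norm (column i Y) \<notin> {0<..<\<nu>})"

definition strong_stationary\<^sub>0 ::
    "(real ^ 'n ^ 'm \<Rightarrow> real) \<Rightarrow> real \<Rightarrow> real \<Rightarrow> ('m::finite, 'n::finite, 'd::finite) factors set" where
  "strong_stationary\<^sub>0 f \<nu> \<sigma> =
     {(X, Y) \<in> stationary\<^sub>0 f \<sigma>. column_consistent X Y \<and> column_bound \<nu> X Y}"

definition strong_stationary\<^sub>R ::
    "(real ^ 'n ^ 'm \<Rightarrow> real) \<Rightarrow> real \<Rightarrow> real \<Rightarrow> real \<Rightarrow> ('m::finite, 'n::finite, 'd::finite) factors set"
  where
  "strong_stationary\<^sub>R f l \<nu> \<sigma> =
     {(X, Y) \<in> stationary\<^sub>R f l \<nu> \<sigma>. column_consistent X Y \<and> column_bound \<nu> X Y}"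

end

theory Submission
  imports Defs
begin

text \<open>
  At every feasible point the relaxed objective is at most the original one, because
  \<open>\<theta>\<^sub>\<nu>(t) \<le> 1\<close> for \<open>t > 0\<close> and \<open>\<theta>\<^sub>\<nu>(0) = 0\<close>; the two agree as soon as no column norm lies in
  \<open>(0, \<nu>)\<close>. Everything about minimizers therefore follows from one fact
  (\<open>local_minimizer_column_bound\<close>): a local minimizer of the relaxed problem has no column norm in
  \<open>(0, \<nu>)\<close>. If the column \<open>X\<^sub>i\<close> were that short, then along the ray \<open>t \<mapsto> (1 + t) X\<^sub>i\<close> the penalty
  would be affine with slope \<open>\<lambda> \<parallel>X\<^sub>i\<parallel> / \<nu>\<close>, and minimality at \<open>t = 0\<close> would produce a limiting
  subgradient \<open>H\<close> of \<open>f\<close> at \<open>X Y\<^sup>T\<close> with \<open>\<langle>H Y\<^sub>i, X\<^sub>i\<rangle> = - \<lambda> \<parallel>X\<^sub>i\<parallel> / \<nu>\<close>. Cauchy-Schwarz gives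
  \<open>\<lambda> / \<nu> \<le> \<parallel>H Y\<^sub>i\<parallel> \<le> \<kappa>\<close>, against \<open>\<nu> < \<lambda> / \<kappa>\<close>. Since the relaxed objective is continuous on a
  compact set, a relaxed global minimizer exists, and \<open>tight_relaxation\<close> identifies global
  minimizers and optimal values. A global minimizer of the original problem is column consistent
  because a column that is paired with a zero column can be set to zero without changing the product.

  The analytic core is \<open>composite_minimizer_multiplier\<close>, a first-order condition for minimizing
  \<open>f \<circ> g\<close> plus a linear function over a compact convex set, where \<open>f\<close> is only locally Lipschitz and
  \<open>g\<close> is smooth. It is used twice: with the affine \<open>g\<close> of the preceding paragraph, and with
  \<open>g(X, Y) = X Y\<^sup>T\<close> on the matrices supported on the common index set \<open>J\<close> of a global minimizer,
  where the column counts are at most those of the minimizer, so that the minimizer minimizes \<open>f\<close>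
  alone. There it supplies a single \<open>H\<close> that serves both factors, that is, stationarity.

  The comparison of stationary points takes place one factor at a time and one column at a time.
  At a relaxed stationary point no nonzero column has norm below \<open>\<nu>\<close>, again by the slope estimate.
  At a nonzero column the selected piece of \<open>\<theta>\<^sub>\<nu>\<close> is therefore the constant one, whose
  subgradients vanish, and what remains of the inclusion on the common support is the original
  stationarity condition. Conversely, at a strong stationary point the selected pieces are minimal, so \<open>0\<close> is a subgradient of the penalty,
  and \<open>H Y\<close> vanishes outside the common support.
\<close>

section \<open>Regular and limiting subgradients\<close>

text \<open>
  The usual reading of a regular subgradient as a support function up to \<open>o(\<parallel>z - x\<parallel>)\<close>, which
  dispenses with extended reals and division.
\<close>

lemma regular_subdiff_iff:
  "\<zeta> \<in> regular_subdiff h x \<longleftrightarrow>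
     (\<forall>\<epsilon>>0. \<forall>\<^sub>F z in at x. h x + \<zeta> \<bullet> (z - x) - \<epsilon> * norm (z - x) \<le> h z)"
proof -
  let ?q = "\<lambda>z. (h z - h x - \<zeta> \<bullet> (z - x)) / norm (z - x)"
  have ne: "\<forall>\<^sub>F z in at x. z \<noteq> x"
    by (simp add: eventually_at_filter)
  have "\<zeta> \<in> regular_subdiff h x \<longleftrightarrow> (\<forall>y<0. \<forall>\<^sub>F z in at x. y < ereal (?q z))"
    by (simp add: regular_subdiff_def le_Liminf_iff)
  also have "\<dots> \<longleftrightarrow> (\<forall>\<epsilon>>0. \<forall>\<^sub>F z in at x. - \<epsilon> \<le> ?q z)"
  proof (intro iffI allI impI)
    fix \<epsilon> :: real
    assume *: "\<forall>y<0. \<forall>\<^sub>F z in at x. y < ereal (?q z)" and "\<epsilon> > 0"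
    then have "\<forall>\<^sub>F z in at x. ereal (-\<epsilon>) < ereal (?q z)"
      by (intro *[rule_format]) simp
    then show "\<forall>\<^sub>F z in at x. - \<epsilon> \<le> ?q z"
      by (rule eventually_mono) simp
  next
    fix y :: ereal
    assume *: "\<forall>\<epsilon>>0. \<forall>\<^sub>F z in at x. - \<epsilon> \<le> ?q z" and "y < 0"
    then obtain e where e: "y < ereal e" "e < 0"
      using ereal_dense2[of y 0] by (auto simp: zero_ereal_def)
    then have "\<forall>\<^sub>F z in at x. - (-e) \<le> ?q z"
      using *[rule_format, of "-e"] by simp
    then show "\<forall>\<^sub>F z in at x. y < ereal (?q z)"
      by (rule eventually_mono) (use e in \<open>auto intro: less_le_trans\<close>)
  qed
  also have "\<dots> \<longleftrightarrow> (\<forall>\<epsilon>>0. \<forall>\<^sub>F z in at x. h x + \<zeta> \<bullet> (z - x) - \<epsilon> * norm (z - x) \<le> h z)"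
  proof (intro all_cong1 imp_cong refl)
    fix \<epsilon> :: real
    have "- \<epsilon> \<le> ?q z \<longleftrightarrow> h x + \<zeta> \<bullet> (z - x) - \<epsilon> * norm (z - x) \<le> h z" if "z \<noteq> x" for z
      using that by (auto simp: field_simps)
    then show "(\<forall>\<^sub>F z in at x. - \<epsilon> \<le> ?q z) \<longleftrightarrow>
        (\<forall>\<^sub>F z in at x. h x + \<zeta> \<bullet> (z - x) - \<epsilon> * norm (z - x) \<le> h z)"
      by (intro eventually_cong[OF ne])
  qed
  finally show ?thesis .
qed

text \<open>
  A quadratic error is of lower order than \<open>\<parallel>z - x\<parallel>\<close>. Penalty methods produce subgradients of this
  kind; for \<open>C = 0\<close> and \<open>\<zeta> = 0\<close> this is Fermat's rule.
\<close>

lemma proximal_imp_regular_subdiff: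
  assumes "\<forall>\<^sub>F z in at x. h x + \<zeta> \<bullet> (z - x) - C * (norm (z - x))\<^sup>2 \<le> h z"
  shows "\<zeta> \<in> regular_subdiff h x"
  unfolding regular_subdiff_iff
proof (intro allI impI)
  fix \<epsilon> :: real
  assume "\<epsilon> > 0"
  have "((\<lambda>z. C * norm (z - x)) \<longlongrightarrow> C * norm (x - x)) (at x)"
    by (intro tendsto_intros)
  then have "\<forall>\<^sub>F z in at x. C * norm (z - x) < \<epsilon>"
    using \<open>\<epsilon> > 0\<close> by (auto dest: order_tendstoD(2))
  with assms show "\<forall>\<^sub>F z in at x. h x + \<zeta> \<bullet> (z - x) - \<epsilon> * norm (z - x) \<le> h z"
  proof eventually_elim
    case (elim z)
    have "C * (norm (z - x))\<^sup>2 \<le> \<epsilon> * norm (z - x)"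
      using mult_right_mono[of "C * norm (z - x)" \<epsilon> "norm (z - x)"] elim(2)
      by (simp add: power2_eq_square mult.assoc)
    with elim(1) show ?case by linarith
  qed
qed

lemma regular_subdiff_subset_limiting: "regular_subdiff h x \<subseteq> limiting_subdiff h x"
proof
  fix \<zeta> assume "\<zeta> \<in> regular_subdiff h x"
  then show "\<zeta> \<in> limiting_subdiff h x"
    unfolding limiting_subdiff_def
    by (intro CollectI exI[of _ "\<lambda>_. x"] exI[of _ "\<lambda>_. \<zeta>"]) auto
qed

lemma eventually_at_along_line:
  fixes x e :: "'a::real_normed_vector"
  assumes "\<forall>\<^sub>F z in at x. P z" and "e \<noteq> 0"
  shows "\<forall>\<^sub>F t in at (0::real). P (x + t *\<^sub>R e)"
proof -
  have "filterlim (\<lambda>t. x + t *\<^sub>R e) (at x) (at 0)"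
    unfolding filterlim_at
  proof
    have "((\<lambda>t. x + t *\<^sub>R e) \<longlongrightarrow> x + 0 *\<^sub>R e) (at 0)"
      by (intro tendsto_intros)
    then show "((\<lambda>t. x + t *\<^sub>R e) \<longlongrightarrow> x) (at 0)" by simp
    show "\<forall>\<^sub>F t in at 0. x + t *\<^sub>R e \<in> UNIV \<and> x + t *\<^sub>R e \<noteq> x"
      using assms(2) by (simp add: eventually_at_filter)
  qed
  then show ?thesis using assms(1) by (simp add: filterlim_iff)
qed

text \<open>
  Moving from \<open>x\<close> in the direction \<open>\<zeta>\<close> itself, the function must grow at rate \<open>\<parallel>\<zeta>\<parallel>\<close>, up to a small
  error, while the Lipschitz bound allows only \<open>L\<close>.
\<close>

lemma regular_subdiff_norm_le:
  assumes z: "\<zeta> \<in> regular_subdiff h x" and L: "L-lipschitz_on U h" and U: "open U" "x \<in> U"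
  shows "norm \<zeta> \<le> L"
proof (cases "\<zeta> = 0")
  case True
  then show ?thesis using lipschitz_on_nonneg[OF L] by simp
next
  case False
  show ?thesis
  proof (rule field_le_epsilon)
    fix \<epsilon> :: real assume "\<epsilon> > 0"
    have "\<forall>\<^sub>F z in at x. h x + \<zeta> \<bullet> (z - x) - \<epsilon> * norm (z - x) \<le> h z"
      using z \<open>\<epsilon> > 0\<close> by (simp add: regular_subdiff_iff)
    moreover have "\<forall>\<^sub>F z in at x. z \<in> U"
      using U eventually_at_topological by blast
    ultimately have "\<forall>\<^sub>F z in at x. h x + \<zeta> \<bullet> (z - x) - \<epsilon> * norm (z - x) \<le> h z \<and> z \<in> U"
      by eventually_elim simp
    from eventually_at_along_line[OF this False]
    obtain d where d: "d > 0" "\<And>t. t \<noteq> 0 \<Longrightarrow> \<bar>t\<bar> < d \<Longrightarrow>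
        h x + \<zeta> \<bullet> (t *\<^sub>R \<zeta>) - \<epsilon> * norm (t *\<^sub>R \<zeta>) \<le> h (x + t *\<^sub>R \<zeta>) \<and> x + t *\<^sub>R \<zeta> \<in> U"
      by (auto simp: eventually_at dist_real_def)
    define t where "t = d / 2"
    have t: "t > 0" "\<bar>t\<bar> < d" "t \<noteq> 0" using d(1) by (auto simp: t_def)
    have 1: "h x + \<zeta> \<bullet> (t *\<^sub>R \<zeta>) - \<epsilon> * norm (t *\<^sub>R \<zeta>) \<le> h (x + t *\<^sub>R \<zeta>)"
      and 2: "x + t *\<^sub>R \<zeta> \<in> U"
      using d(2)[OF t(3,2)] by auto
    have "h (x + t *\<^sub>R \<zeta>) - h x \<le> L * norm (t *\<^sub>R \<zeta>)"
      using lipschitz_onD[OF L 2 U(2)] by (simp add: dist_norm abs_le_iff)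
    with 1 have "t * norm \<zeta> * norm \<zeta> \<le> t * norm \<zeta> * (L + \<epsilon>)"
      using t(1) by (simp add: dot_square_norm power2_eq_square algebra_simps)
    then show "norm \<zeta> \<le> L + \<epsilon>"
      using t(1) False by simp
  qed
qed

text \<open>
  Along a line on which the function is affine, the subgradient inequality holds in both directions
  and determines the component of the subgradient.
\<close>

lemma regular_subdiff_affine_line:
  assumes z: "\<zeta> \<in> regular_subdiff h x"
    and aff: "\<And>t. \<bar>t\<bar> \<le> 1 \<Longrightarrow> h (x + t *\<^sub>R e) = h x + t * a"
  shows "\<zeta> \<bullet> e = a"
proof (cases "e = 0")
  case True
  then show ?thesis using aff[of 1] by simp
next
  case False
  have *: "\<bar>\<zeta> \<bullet> e - a\<bar> \<le> \<epsilon> * norm e" if "\<epsilon> > 0" for \<epsilon>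
  proof -
    have "\<forall>\<^sub>F z in at x. h x + \<zeta> \<bullet> (z - x) - \<epsilon> * norm (z - x) \<le> h z"
      using z that by (simp add: regular_subdiff_iff)
    from eventually_at_along_line[OF this False]
    obtain d where d: "d > 0" "\<And>t. t \<noteq> 0 \<Longrightarrow> \<bar>t\<bar> < d \<Longrightarrow>
        h x + \<zeta> \<bullet> (t *\<^sub>R e) - \<epsilon> * norm (t *\<^sub>R e) \<le> h (x + t *\<^sub>R e)"
      by (auto simp: eventually_at dist_real_def)
    define t where "t = min (d / 2) 1"
    have t: "t > 0" "t < d" "t \<le> 1" using d(1) by (auto simp: t_def)
    have "t * (\<zeta> \<bullet> e - a) \<le> t * (\<epsilon> * norm e)"
      using d(2)[of t] aff[of t] t by (simp add: algebra_simps)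
    moreover have "t * (a - \<zeta> \<bullet> e) \<le> t * (\<epsilon> * norm e)"
      using d(2)[of "-t"] aff[of "-t"] t by (simp add: algebra_simps)
    ultimately show ?thesis using t(1) by (simp add: abs_le_iff)
  qed
  have "\<bar>\<zeta> \<bullet> e - a\<bar> \<le> 0"
  proof (rule field_le_epsilon)
    fix \<epsilon> :: real assume "\<epsilon> > 0"
    then show "\<bar>\<zeta> \<bullet> e - a\<bar> \<le> 0 + \<epsilon>"
      using *[of "\<epsilon> / norm e"] False by simp
  qed
  then show ?thesis by simp
qed

text \<open>
  The direction \<open>E z\<close> depends on the point, because the radial direction of a norm does: passing to
  the limit in \<open>\<zeta>\<^sub>k \<bullet> E(z\<^sub>k) = a(z\<^sub>k)\<close> yields the limiting subgradients of norms without any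
  subdifferential calculus.
\<close>

lemma limiting_subdiff_affine_lines:
  assumes z: "\<zeta> \<in> limiting_subdiff h x"
    and aff: "\<And>z t. \<bar>t\<bar> \<le> 1 \<Longrightarrow> h (z + t *\<^sub>R E z) = h z + t * a z"
    and cont: "isCont E x" "isCont a x"
  shows "\<zeta> \<bullet> E x = a x"
proof -
  obtain xs \<zeta>s where s: "xs \<longlonglongrightarrow> x" "\<And>k. \<zeta>s k \<in> regular_subdiff h (xs k)" "\<zeta>s \<longlonglongrightarrow> \<zeta>"
    using z by (auto simp: limiting_subdiff_def)
  have "(\<lambda>k. \<zeta>s k \<bullet> E (xs k)) \<longlonglongrightarrow> \<zeta> \<bullet> E x"
    by (intro tendsto_intros s isCont_tendsto_compose[OF cont(1)])
  moreover have "(\<lambda>k. \<zeta>s k \<bullet> E (xs k)) = (\<lambda>k. a (xs k))"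
    using regular_subdiff_affine_line[OF s(2) aff] by auto
  moreover have "(\<lambda>k. a (xs k)) \<longlonglongrightarrow> a x"
    by (intro s isCont_tendsto_compose[OF cont(2)])
  ultimately show ?thesis using LIMSEQ_unique by metis
qed

section \<open>A multiplier rule for composite minimization\<close>

lemma locally_lipschitz_imp_continuous:
  assumes "locally_lipschitz h"
  shows "continuous_on UNIV h"
proof -
  have "isCont h x" for x
  proof -
    obtain u L where "u > 0" "L-lipschitz_on (ball x u) h"
      using assms unfolding locally_lipschitz_def by blast
    then show ?thesis
      using lipschitz_on_continuous_on continuous_on_interior by fastforce
  qed
  then show ?thesis by (simp add: continuous_at_imp_continuous_on)
qed

lemma convex_minimizer_derivative_nonneg:
  assumes S: "convex S" "u \<in> S" "w \<in> S"
    and der: "(\<psi> has_derivative D) (at u within S)"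
    and min: "\<And>v. v \<in> S \<Longrightarrow> \<psi> u \<le> (\<psi> v :: real)"
  shows "0 \<le> D (w - u)"
proof -
  let ?p = "\<lambda>t::real. u + t *\<^sub>R (w - u)"
  have inS: "?p t \<in> S" if "t \<in> {0..1}" for t
    using convexD_alt[OF S, of t] that by (simp add: algebra_simps)
  have "(\<psi> has_derivative D) (at (?p 0) within ?p ` {0..1})"
    using inS by (auto intro!: has_derivative_subset[OF der])
  moreover have "(?p has_derivative (\<lambda>t. t *\<^sub>R (w - u))) (at 0 within {0..1})"
    by (auto intro!: derivative_eq_intros)
  ultimately have "((\<lambda>t. \<psi> (?p t)) has_derivative (\<lambda>t. D (t *\<^sub>R (w - u)))) (at 0 within {0..1})"
    using has_derivative_in_compose[of ?p _ 0 "{0..1}" \<psi> D] by simp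
  moreover have "(\<lambda>t. D (t *\<^sub>R (w - u))) = (*) (D (w - u))"
    using linear_scale[OF has_derivative_linear[OF der]] by (auto simp: fun_eq_iff)
  ultimately have "((\<lambda>t. \<psi> (?p t)) has_field_derivative D (w - u)) (at 0 within {0..1})"
    by (simp add: has_field_derivative_def)
  then have "((\<lambda>t. (\<psi> (?p t) - \<psi> u) / t) \<longlongrightarrow> D (w - u)) (at 0 within {0..1})"
    by (simp add: has_field_derivative_iff)
  moreover have "\<forall>\<^sub>F t in at 0 within {0..1}. 0 \<le> (\<psi> (?p t) - \<psi> u) / t"
    using min inS by (auto simp: eventually_at_filter)
  moreover have "at (0::real) within {0..1} \<noteq> bot"
    by (simp add: at_within_Icc_at_right)
  ultimately show ?thesis by (rule tendsto_lowerbound)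
qed

text \<open>
  The two functions are decoupled: \<open>g u\<close> is replaced by an independent variable \<open>z\<close> in a unit ball
  (for compactness) and the penalty \<open>\<rho> / 2 \<parallel>z - g u\<parallel>\<^sup>2\<close> enforces \<open>z = g u\<close> in the limit.
  Optimality in \<open>z\<close> makes \<open>H = \<rho> (g u - z)\<close> a proximal subgradient of \<open>f\<close> at \<open>z\<close>; optimality in
  \<open>u\<close>, where only smooth terms occur, is the desired inequality for this same \<open>H\<close> up to a vanishing
  error. Since \<open>f\<close> is locally Lipschitz, the multipliers \<open>H\<close> are bounded, so they have a limit
  point. The result is the chain and sum rule inclusion \<open>0 \<in> (g' x)\<^sup>T \<partial>f(g x) + c + N\<^sub>S(x)\<close>.
\<close>

lemma composite_minimizer_multiplier:
  fixes f :: "'b::euclidean_space \<Rightarrow> real" and g :: "'a::euclidean_space \<Rightarrow> 'b"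
  assumes f: "locally_lipschitz f"
    and S: "compact S" "convex S" "x \<in> S"
    and g: "\<And>u. u \<in> S \<Longrightarrow> (g has_derivative g' u) (at u within S)"
    and g': "\<And>v. isCont (\<lambda>(u, w). g' u w) (x, v)"
    and min: "\<And>u. u \<in> S \<Longrightarrow> f (g x) + c \<bullet> x \<le> f (g u) + c \<bullet> u"
  shows "\<exists>H \<in> limiting_subdiff f (g x). \<forall>w\<in>S. 0 \<le> H \<bullet> g' x (w - x) + c \<bullet> (w - x)"
proof -
  define K where "K = S \<times> cball (g x) 1"
  have fcont: "continuous_on UNIV f"
    by (rule locally_lipschitz_imp_continuous[OF f])
  have gcont: "continuous_on S g"
    using g has_derivative_continuous continuous_on_eq_continuous_within by blast
  have K: "compact K" "(x, g x) \<in> K"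
    using S by (auto simp: K_def intro!: compact_Times)
  have fc: "continuous_on K (\<lambda>p. f (snd p))"
    by (intro continuous_on_compose2[OF fcont] continuous_intros) auto
  have gc: "continuous_on K (\<lambda>p. g (fst p))"
    by (intro continuous_on_compose2[OF gcont] continuous_intros) (auto simp: K_def)
  define \<rho> :: "nat \<Rightarrow> real" where "\<rho> k = real (Suc k)" for k
  have \<rho>: "\<rho> k > 0" for k by (simp add: \<rho>_def)
  define Q where "Q k p = f (snd p) + c \<bullet> fst p + \<rho> k / 2 * (norm (snd p - g (fst p)))\<^sup>2
      + (norm (fst p - x))\<^sup>2 / 2" for k p
  have "\<exists>p\<in>K. \<forall>q\<in>K. Q k p \<le> Q k q" for k
    unfolding Q_def
    by (rule continuous_attains_inf) (use K in \<open>auto intro!: continuous_intros fc gc\<close>)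
  then obtain p where pK: "p k \<in> K" and pmin: "\<And>q. q \<in> K \<Longrightarrow> Q k (p k) \<le> Q k q" for k
    by metis
  define u where "u k = fst (p k)" for k
  define z where "z k = snd (p k)" for k
  have p: "p k = (u k, z k)" for k by (simp add: u_def z_def)
  have uS: "u k \<in> S" and zK: "z k \<in> cball (g x) 1" for k
    using pK[of k] by (auto simp: p K_def)
  have bound: "f (z k) + c \<bullet> u k + \<rho> k / 2 * (norm (z k - g (u k)))\<^sup>2 + (norm (u k - x))\<^sup>2 / 2
      \<le> f (g x) + c \<bullet> x" for k
    using pmin[OF K(2), of k] by (simp add: Q_def p)
  \<comment> \<open>The penalty forces feasibility in the limit.\<close>
  have "\<exists>q\<in>K. \<forall>r\<in>K. f (snd q) + c \<bullet> fst q \<le> f (snd r) + c \<bullet> fst r"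
    by (rule continuous_attains_inf) (use K in \<open>auto intro!: continuous_intros fc\<close>)
  then obtain b where b: "\<And>r. r \<in> K \<Longrightarrow> b \<le> f (snd r) + c \<bullet> fst r" by metis
  define M where "M = 2 * (f (g x) + c \<bullet> x - b)"
  \<comment> \<open>At most \<open>M / 2\<close> can be gained by violating \<open>z = g u\<close>, so the penalty stays below it.\<close>
  have gap: "(norm (z k - g (u k)))\<^sup>2 \<le> M * inverse (\<rho> k)" for k
  proof -
    have "\<rho> k * (norm (z k - g (u k)))\<^sup>2 \<le> M"
      using bound[of k] b[OF pK[of k]] zero_le_power2[of "norm (u k - x)"]
      unfolding p M_def fst_conv snd_conv times_divide_eq_left by argo
    then show ?thesis using \<rho>[of k] by (simp add: field_simps)
  qed
  have "(\<lambda>k. M * inverse (\<rho> k)) \<longlonglongrightarrow> 0"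
    using tendsto_mult[OF tendsto_const LIMSEQ_inverse_real_of_nat, of M] by (simp add: \<rho>_def)
  then have "(\<lambda>k. (norm (z k - g (u k)))\<^sup>2) \<longlonglongrightarrow> 0"
    by (rule Lim_null_comparison[rotated]) (use gap in auto)
  then have gap0: "(\<lambda>k. z k - g (u k)) \<longlonglongrightarrow> 0"
    by (simp add: tendsto_norm_zero_iff)
  obtain q s where q: "q \<in> K" "strict_mono (s :: nat \<Rightarrow> nat)" "(p \<circ> s) \<longlonglongrightarrow> q"
    using K(1) pK unfolding compact_def by blast
  obtain ul zl where ql: "q = (ul, zl)" by (cases q)
  have ul: "(u \<circ> s) \<longlonglongrightarrow> ul" "ul \<in> S" and zl: "(z \<circ> s) \<longlonglongrightarrow> zl"
    using tendsto_fst[OF q(3)] tendsto_snd[OF q(3)] q(1)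
    by (auto simp: ql u_def z_def o_def K_def)
  have gul: "(\<lambda>k. g ((u \<circ> s) k)) \<longlonglongrightarrow> g ul"
    using continuous_on_tendsto_compose[OF gcont ul] uS by simp
  have "(\<lambda>k. (z \<circ> s) k - g ((u \<circ> s) k)) \<longlonglongrightarrow> 0"
    using LIMSEQ_subseq_LIMSEQ[OF gap0 q(2)] by (simp add: o_def)
  with tendsto_diff[OF zl gul] have zgl: "zl = g ul"
    using LIMSEQ_unique by fastforce
  \<comment> \<open>The minimizer need not be unique; the term \<open>\<parallel>u - x\<parallel>\<^sup>2 / 2\<close> forces the limit to be \<open>x\<close>.\<close>
  have "(\<lambda>k. f ((z \<circ> s) k) + c \<bullet> (u \<circ> s) k + (norm ((u \<circ> s) k - x))\<^sup>2 / 2)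
      \<longlonglongrightarrow> f zl + c \<bullet> ul + (norm (ul - x))\<^sup>2 / 2"
    by (intro tendsto_intros ul zl continuous_on_tendsto_compose[OF fcont]) auto
  moreover have "f ((z \<circ> s) k) + c \<bullet> (u \<circ> s) k + (norm ((u \<circ> s) k - x))\<^sup>2 / 2 \<le> f (g x) + c \<bullet> x" for k
  proof -
    have "0 \<le> \<rho> (s k) / 2 * (norm (z (s k) - g (u (s k))))\<^sup>2"
      using \<rho>[of "s k"] by simp
    then show ?thesis using bound[of "s k"] by simp
  qed
  ultimately have "f zl + c \<bullet> ul + (norm (ul - x))\<^sup>2 / 2 \<le> f (g x) + c \<bullet> x"
    by (intro LIMSEQ_le_const2) auto
  with min[OF ul(2)] have "(norm (ul - x))\<^sup>2 \<le> 0"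
    unfolding zgl by argo
  then have ulx: "ul = x" by simp
  with ul zl zgl have ulim: "(u \<circ> s) \<longlonglongrightarrow> x" and zlim: "(z \<circ> s) \<longlonglongrightarrow> g x" by auto
  define H where "H k = \<rho> k *\<^sub>R (g (u k) - z k)" for k
  have H_regular: "H k \<in> regular_subdiff f (z k)" if "z k \<in> ball (g x) 1" for k
  proof (rule proximal_imp_regular_subdiff)
    have "f (z k) + H k \<bullet> (y - z k) - \<rho> k / 2 * (norm (y - z k))\<^sup>2 \<le> f y"
      if "y \<in> ball (g x) 1" for y
    proof -
      have "Q k (u k, z k) \<le> Q k (u k, y)"
        using pmin[of "(u k, y)" k] uS that by (simp add: p K_def)
      moreover have "(norm (y - g (u k)))\<^sup>2 = (norm (z k - g (u k)))\<^sup>2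
          - 2 * ((g (u k) - z k) \<bullet> (y - z k)) + (norm (y - z k))\<^sup>2"
        unfolding power2_norm_eq_inner by (simp add: algebra_simps inner_commute)
      ultimately show ?thesis
        by (simp add: Q_def H_def algebra_simps)
    qed
    moreover have "\<forall>\<^sub>F y in at (z k). y \<in> ball (g x) 1"
      using that open_ball eventually_at_topological by blast
    ultimately show "\<forall>\<^sub>F y in at (z k). f (z k) + H k \<bullet> (y - z k) - \<rho> k / 2 * (norm (y - z k))\<^sup>2 \<le> f y"
      by (auto elim: eventually_mono)
  qed
  have H_first_order: "0 \<le> H k \<bullet> g' (u k) (w - u k) + c \<bullet> (w - u k) + (u k - x) \<bullet> (w - u k)"
    if "w \<in> S" for w k
  proof -
    define \<psi> where "\<psi> v = c \<bullet> v + \<rho> k / 2 * ((z k - g v) \<bullet> (z k - g v)) + (v - x) \<bullet> (v - x) / 2" for v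
    have "\<psi> (u k) \<le> \<psi> v" if "v \<in> S" for v
      using pmin[of "(v, z k)" k] zK[of k] that
      by (simp add: p K_def Q_def \<psi>_def power2_norm_eq_inner)
    moreover have "(\<psi> has_derivative (\<lambda>h. c \<bullet> h + H k \<bullet> g' (u k) h + (u k - x) \<bullet> h)) (at (u k) within S)"
      unfolding \<psi>_def
      by (auto intro!: derivative_eq_intros g[OF uS] simp: H_def inner_commute algebra_simps diff_divide_distrib)
    ultimately have "0 \<le> c \<bullet> (w - u k) + H k \<bullet> g' (u k) (w - u k) + (u k - x) \<bullet> (w - u k)"
      using convex_minimizer_derivative_nonneg[OF S(2) uS that, where \<psi> = \<psi>] by blast
    then show ?thesis by simp
  qed
  \<comment> \<open>The multipliers are bounded by the Lipschitz constant, so a subsequence converges.\<close>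
  obtain r L where r: "r > 0" "L-lipschitz_on (ball (g x) r) f"
    using f unfolding locally_lipschitz_def by blast
  have "\<forall>\<^sub>F k in sequentially. (z \<circ> s) k \<in> ball (g x) (min r 1)"
    by (rule topological_tendstoD[OF zlim open_ball]) (use r(1) in simp)
  then obtain N where N: "\<And>k. k \<ge> N \<Longrightarrow> z (s k) \<in> ball (g x) (min r 1)"
    by (auto simp: eventually_sequentially)
  define n where "n k = s (k + N)" for k
  have n: "z (n k) \<in> ball (g x) 1" "z (n k) \<in> ball (g x) r" for k
    using N[of "k + N"] by (auto simp: n_def)
  have "norm (H (n k)) \<le> L" for k
    by (rule regular_subdiff_norm_le[OF H_regular r(2)]) (use n in auto)
  then have "\<forall>k. (H \<circ> n) k \<in> cball 0 L" by simp
  then obtain Hl t where t: "strict_mono (t :: nat \<Rightarrow> nat)" and Hl: "((H \<circ> n) \<circ> t) \<longlonglongrightarrow> Hl"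
    using compact_cball[of "0::'b" L] unfolding compact_def by blast
  have ulim': "(\<lambda>k. u (n (t k))) \<longlonglongrightarrow> x" and zlim': "(\<lambda>k. z (n (t k))) \<longlonglongrightarrow> g x"
    using LIMSEQ_subseq_LIMSEQ[OF LIMSEQ_ignore_initial_segment[OF ulim, of N] t]
      LIMSEQ_subseq_LIMSEQ[OF LIMSEQ_ignore_initial_segment[OF zlim, of N] t]
    by (simp_all add: o_def n_def)
  have Hlim: "(\<lambda>k. H (n (t k))) \<longlonglongrightarrow> Hl" using Hl by (simp add: o_def)
  have "Hl \<in> limiting_subdiff f (g x)"
    unfolding limiting_subdiff_def
  proof (intro CollectI exI conjI allI)
    show "(\<lambda>k. f (z (n (t k)))) \<longlonglongrightarrow> f (g x)"
      using continuous_on_tendsto_compose[OF fcont zlim'] by simp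
    show "H (n (t k)) \<in> regular_subdiff f (z (n (t k)))" for k
      using H_regular n by blast
  qed (fact zlim' Hlim)+
  moreover have "0 \<le> Hl \<bullet> g' x (w - x) + c \<bullet> (w - x)" if "w \<in> S" for w
  proof (rule LIMSEQ_le_const)
    have "(\<lambda>k. g' (u (n (t k))) (w - u (n (t k)))) \<longlonglongrightarrow> g' x (w - x)"
      using isCont_tendsto_compose[OF g'[of "w - x"], of "\<lambda>k. (u (n (t k)), w - u (n (t k)))"]
      by (simp add: tendsto_Pair tendsto_diff ulim')
    then have "(\<lambda>k. H (n (t k)) \<bullet> g' (u (n (t k))) (w - u (n (t k))) + c \<bullet> (w - u (n (t k)))
          + (u (n (t k)) - x) \<bullet> (w - u (n (t k))))
        \<longlonglongrightarrow> Hl \<bullet> g' x (w - x) + c \<bullet> (w - x) + (x - x) \<bullet> (w - x)"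
      by (intro tendsto_intros Hlim ulim')
    then show "(\<lambda>k. H (n (t k)) \<bullet> g' (u (n (t k))) (w - u (n (t k))) + c \<bullet> (w - u (n (t k)))
          + (u (n (t k)) - x) \<bullet> (w - u (n (t k)))) \<longlonglongrightarrow> Hl \<bullet> g' x (w - x) + c \<bullet> (w - x)"
      by simp
  qed (use H_first_order that in auto)
  ultimately show ?thesis by blast
qed

text \<open>
  On a two-sided segment the variational inequality becomes an equation.
\<close>

lemma segment_minimizer_multiplier:
  fixes f :: "'b::euclidean_space \<Rightarrow> real"
  assumes f: "locally_lipschitz f" and r: "r > 0"
    and min: "\<And>t. \<bar>t\<bar> \<le> r \<Longrightarrow> f Z \<le> f (Z + t *\<^sub>R D) + t * c"
  shows "\<exists>H \<in> limiting_subdiff f Z. H \<bullet> D = - c"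
proof -
  have "\<exists>H\<in>limiting_subdiff f (Z + 0 *\<^sub>R D). \<forall>w\<in>{-r..r}. 0 \<le> H \<bullet> ((w - 0) *\<^sub>R D) + c \<bullet> (w - 0)"
  proof (rule composite_minimizer_multiplier[OF f, where g' = "\<lambda>_ h. h *\<^sub>R D"])
    show "((\<lambda>t. Z + t *\<^sub>R D) has_derivative (\<lambda>h. h *\<^sub>R D)) (at u within {-r..r})" for u
      by (auto intro!: derivative_eq_intros)
    show "isCont (\<lambda>(u, w). w *\<^sub>R D) (0, v)" for v :: real
      unfolding case_prod_unfold by (intro continuous_intros)
  qed (use r min in \<open>auto simp: mult.commute\<close>)
  then obtain H where H: "H \<in> limiting_subdiff f Z"
      "\<And>w. w \<in> {-r..r} \<Longrightarrow> 0 \<le> w * (H \<bullet> D) + c * w"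
    by auto
  have "0 \<le> r * (H \<bullet> D + c)" "0 \<le> r * (- (H \<bullet> D + c))"
    using H(2)[of r] H(2)[of "-r"] r by (auto simp: algebra_simps)
  then have "H \<bullet> D = - c" using r by (auto simp: zero_le_mult_iff)
  with H(1) show ?thesis by blast
qed

section \<open>Columns, supports and products of matrices\<close>

lemma matrix_eq_columnI:
  assumes "\<And>j. column j A = column j B"
  shows "A = B"
  using assms by (simp add: vec_eq_iff column_def)

lemma column_add: "column j (A + B) = column j A + column j B"
  and column_diff: "column j (A - B) = column j A - column j B"
  and column_uminus: "column j (- A) = - column j A"
  and column_scaleR: "column j (t *\<^sub>R A) = t *\<^sub>R column j A"
  and column_zero: "column j 0 = 0"
  for A B :: "real ^ 'd ^ 'r"
  by (simp_all add: vec_eq_iff column_def)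

lemma column_matrix_mult: "column j (A ** B) = A *v column j B"
  for A :: "real ^ 'k ^ 'r"
  by (simp add: vec_eq_iff column_def matrix_matrix_mult_def matrix_vector_mult_def)

lemma column_cols: "column j (cols J C) = (if j \<in> J then column j C else 0)"
  by (simp add: vec_eq_iff column_def cols_def)

lemmas column_simps =
  column_add column_diff column_uminus column_scaleR column_zero column_matrix_mult column_cols

lemma inner_columns: "A \<bullet> B = (\<Sum>j\<in>UNIV. column j A \<bullet> column j B)"
  for A B :: "real ^ 'd ^ 'r"
  unfolding inner_vec_def column_def by (simp, rule sum.swap)

lemma inner_cols_left: "cols J A \<bullet> B = (\<Sum>j\<in>J. column j A \<bullet> column j B)"
  for A B :: "real ^ 'd::finite ^ 'r"
  unfolding inner_columns by (rule sum.mono_neutral_cong_right) (auto simp: column_cols)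

lemma inner_cols_commute: "cols J A \<bullet> B = A \<bullet> cols J B"
  for A B :: "real ^ 'd::finite ^ 'r"
  unfolding inner_columns by (rule sum.cong) (auto simp: column_cols)

lemma inner_transpose: "transpose A \<bullet> transpose B = A \<bullet> B"
  for A B :: "real ^ 'n ^ 'm"
  unfolding inner_vec_def transpose_def by (simp, rule sum.swap)

text \<open>
  This and \<open>inner_mult_transpose_right\<close> compute the adjoints of \<open>E \<mapsto> E Y\<^sup>T\<close> and
  \<open>E \<mapsto> X E\<^sup>T\<close>, which turn the derivative of the product into the terms \<open>H Y\<close> and \<open>H\<^sup>T X\<close> of the
  stationarity conditions.
\<close>

lemma inner_mult_transpose_left: "H \<bullet> (E ** transpose Y) = (H ** Y) \<bullet> E"
  for H :: "real ^ 'n ^ 'm" and E :: "real ^ 'd ^ 'm" and Y :: "real ^ 'd ^ 'n"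
proof -
  have "H \<bullet> (E ** transpose Y) = (\<Sum>i\<in>UNIV. \<Sum>j\<in>UNIV. \<Sum>k\<in>UNIV. H $ i $ j * (E $ i $ k * Y $ j $ k))"
    by (simp add: inner_vec_def matrix_matrix_mult_def transpose_def sum_distrib_left)
  also have "\<dots> = (\<Sum>i\<in>UNIV. \<Sum>k\<in>UNIV. \<Sum>j\<in>UNIV. H $ i $ j * (E $ i $ k * Y $ j $ k))"
    by (intro sum.cong refl sum.swap)
  also have "\<dots> = (H ** Y) \<bullet> E"
    by (simp add: inner_vec_def matrix_matrix_mult_def sum_distrib_left sum_distrib_right ac_simps)
  finally show ?thesis .
qed

lemma inner_mult_transpose_right: "H \<bullet> (X ** transpose E) = (transpose H ** X) \<bullet> E"
  for H :: "real ^ 'n ^ 'm" and X :: "real ^ 'd ^ 'm" and E :: "real ^ 'd ^ 'n"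
  using inner_transpose[of H "X ** transpose E"] inner_mult_transpose_left[of "transpose H" E X]
  by (simp add: matrix_transpose_mul)

lemma bounded_bilinear_mult_transpose:
  "bounded_bilinear (\<lambda>(X :: real ^ 'd ^ 'm) (Y :: real ^ 'd ^ 'n). X ** transpose Y)"
proof -
  have "bilinear (\<lambda>(X :: real ^ 'd ^ 'm) (Y :: real ^ 'd ^ 'n). X ** transpose Y)"
    unfolding bilinear_def
    by (auto intro!: linearI
        simp: vec_eq_iff matrix_matrix_mult_def transpose_def algebra_simps sum.distrib sum_distrib_left)
  then show ?thesis by (simp add: bilinear_conv_bounded_bilinear)
qed

text \<open>
  The product \<open>X Y\<^sup>T\<close> is the sum of the outer products of corresponding columns, and an outer product
  with a zero factor does not depend on the other factor.
\<close>

lemma mult_transpose_columns_cong: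
  fixes X X' :: "real ^ 'd ^ 'm" and Y Y' :: "real ^ 'd ^ 'n"
  assumes "\<And>j. column j X' = column j X \<and> column j Y' = column j Y
      \<or> (column j X = 0 \<or> column j Y = 0) \<and> (column j X' = 0 \<or> column j Y' = 0)"
  shows "X' ** transpose Y' = X ** transpose Y"
proof -
  have "X' $ i $ j * Y' $ k $ j = X $ i $ j * Y $ k $ j" for i j k
    using assms[of j] by (auto simp: column_def vec_eq_iff)
  then show ?thesis
    by (simp add: vec_eq_iff matrix_matrix_mult_def transpose_def)
qed

lemma linear_cols: "linear (cols J :: real ^ 'd ^ 'r \<Rightarrow> _)"
proof (rule linearI)
  show "cols J (A + B) = cols J A + cols J B" for A B :: "real ^ 'd ^ 'r"
    by (rule matrix_eq_columnI) (simp add: column_simps)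
  show "cols J (t *\<^sub>R A) = t *\<^sub>R cols J A" for t and A :: "real ^ 'd ^ 'r"
    by (rule matrix_eq_columnI) (simp add: column_simps)
qed

lemma matrix_mult_cols: "H ** cols J Y = cols J (H ** Y)"
  for H :: "real ^ 'n ^ 'm"
  by (rule matrix_eq_columnI) (simp add: column_simps)

lemma cols_idem: "cols J (cols J C) = cols J C"
  by (rule matrix_eq_columnI) (simp add: column_simps)

lemma cols_uminus: "cols J (- C) = - cols J C" for C :: "real ^ 'd ^ 'r"
  by (rule matrix_eq_columnI) (simp add: column_simps)

lemma cols_nz_cols: "nz_cols C \<subseteq> J \<Longrightarrow> cols J C = C"
  by (rule matrix_eq_columnI) (auto simp: column_simps nz_cols_def)

lemma nz_cols_cols: "nz_cols (cols J C) = J \<inter> nz_cols C"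
  by (auto simp: nz_cols_def column_simps split: if_splits)

lemma nz_cols_mult: "nz_cols (H ** Y) \<subseteq> nz_cols Y"
  for H :: "real ^ 'n ^ 'm"
  by (auto simp: nz_cols_def column_simps)

lemma compact_Omega: "compact (Omega \<sigma> :: (real ^ 'd ^ 'r) set)"
proof -
  have "Omega \<sigma> = (\<Inter>i. (\<lambda>C :: real ^ 'd ^ 'r. norm (column i C)) -` {..\<sigma>})"
    by (auto simp: Omega_def)
  moreover have "continuous_on UNIV (\<lambda>C :: real ^ 'd ^ 'r. norm (column i C))" for i
    unfolding column_def by (intro continuous_intros)
  ultimately have "closed (Omega \<sigma> :: (real ^ 'd ^ 'r) set)"
    by (auto intro!: closed_INT closed_vimage)
  moreover have "norm C \<le> sqrt (CARD('d) * \<sigma>\<^sup>2)" if "C \<in> Omega \<sigma>" for C :: "real ^ 'd ^ 'r"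
  proof -
    have "C \<bullet> C \<le> (\<Sum>j\<in>(UNIV :: 'd set). \<sigma>\<^sup>2)"
      unfolding inner_columns using that
      by (intro sum_mono) (auto simp: Omega_def dot_square_norm intro!: power_mono)
    then show ?thesis by (simp add: norm_eq_sqrt_inner)
  qed
  then have "bounded (Omega \<sigma> :: (real ^ 'd ^ 'r) set)" by (auto simp: bounded_iff)
  ultimately show ?thesis by (simp add: compact_eq_bounded_closed)
qed

lemma convex_Omega: "convex (Omega \<sigma> :: (real ^ 'd ^ 'r) set)"
proof (rule convexI)
  fix A B :: "real ^ 'd ^ 'r" and u v :: real
  assume *: "A \<in> Omega \<sigma>" "B \<in> Omega \<sigma>" "0 \<le> u" "0 \<le> v" "u + v = 1"
  have "norm (u *\<^sub>R a + v *\<^sub>R b) \<le> \<sigma>" if "norm a \<le> \<sigma>" "norm b \<le> \<sigma>" for a b :: "real ^ 'r"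
    using convexD[OF convex_cball[of 0 \<sigma>], of a b u v] that * by simp
  with * show "u *\<^sub>R A + v *\<^sub>R B \<in> Omega \<sigma>"
    by (simp add: Omega_def column_simps)
qed

lemma cols_Omega: "X \<in> Omega \<sigma> \<Longrightarrow> cols J X \<in> Omega \<sigma>"
  by (auto simp: Omega_def column_simps intro: order_trans[OF norm_ge_zero])

section \<open>Tightness of the relaxed penalty\<close>

lemma nnzc_eq_sum: "real (nnzc C) = (\<Sum>i\<in>UNIV. if column i C = 0 then 0 else 1)"
  by (simp add: nnzc_def nz_cols_def sum.If_cases Compl_eq)

lemma theta_eq: "\<nu> > 0 \<Longrightarrow> theta \<nu> t = (if t < \<nu> then t / \<nu> else 1)"
  by (auto simp: theta_def theta_piece_def min_def divide_simps)

lemma Theta_le_nnzc: "\<nu> > 0 \<Longrightarrow> Theta \<nu> C \<le> real (nnzc C)"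
  unfolding Theta_def nnzc_eq_sum by (intro sum_mono) (auto simp: theta_eq)

lemma Theta_eq_nnzc:
  assumes "\<nu> > 0" "\<And>i. norm (column i C) \<notin> {0<..<\<nu>}"
  shows "Theta \<nu> C = real (nnzc C)"
  unfolding Theta_def nnzc_eq_sum
proof (rule sum.cong)
  fix i
  show "theta \<nu> (norm (column i C)) = (if column i C = 0 then 0 else 1)"
    using assms(1) assms(2)[of i] by (auto simp: theta_eq)
qed simp

lemma F\<^sub>R_le_F\<^sub>0: "l > 0 \<Longrightarrow> \<nu> > 0 \<Longrightarrow> F\<^sub>R f l \<nu> p \<le> F\<^sub>0 f l p"
  unfolding F\<^sub>R_def F\<^sub>0_def by (auto simp: Theta_le_nnzc add_mono split: prod.split)

lemma F\<^sub>R_eq_F\<^sub>0: "\<nu> > 0 \<Longrightarrow> column_bound \<nu> X Y \<Longrightarrow> F\<^sub>R f l \<nu> (X, Y) = F\<^sub>0 f l (X, Y)"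
  unfolding F\<^sub>R_def F\<^sub>0_def column_bound_def by (simp add: Theta_eq_nnzc)

lemma continuous_on_Theta: "continuous_on UNIV (Theta \<nu> :: real ^ 'd ^ 'r \<Rightarrow> real)"
  by (auto simp: Theta_def theta_def theta_piece_def column_def divide_inverse
      intro!: continuous_intros)

lemma F\<^sub>R_minimizer_exists:
  fixes f :: "real ^ 'n ^ 'm \<Rightarrow> real"
  assumes "locally_lipschitz f" "\<sigma> \<ge> 0"
  shows "(G\<^sub>R f l \<nu> \<sigma> :: ('m::finite, 'n::finite, 'd::finite) factors set) \<noteq> {}"
proof -
  note Theta = continuous_on_compose2[OF continuous_on_Theta]
  interpret P: bounded_bilinear "\<lambda>(X :: real ^ 'd ^ 'm) (Y :: real ^ 'd ^ 'n). X ** transpose Y"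
    by (rule bounded_bilinear_mult_transpose)
  note fc = continuous_on_compose2[OF locally_lipschitz_imp_continuous[OF assms(1)]]
  have "\<exists>p\<in>feasible \<sigma> :: ('m, 'n, 'd) factors set.
      \<forall>q\<in>feasible \<sigma> :: ('m, 'n, 'd) factors set. F\<^sub>R f l \<nu> p \<le> F\<^sub>R f l \<nu> q"
  proof (rule continuous_attains_inf)
    show "compact (feasible \<sigma> :: ('m, 'n, 'd) factors set)"
      unfolding feasible_def by (intro compact_Times compact_Omega)
    have "0 \<in> (feasible \<sigma> :: ('m, 'n, 'd) factors set)"
      using assms(2) by (simp add: feasible_def Omega_def column_simps zero_prod_def)
    then show "(feasible \<sigma> :: ('m, 'n, 'd) factors set) \<noteq> {}" by blast
    show "continuous_on (feasible \<sigma>) (F\<^sub>R f l \<nu> :: ('m, 'n, 'd) factors \<Rightarrow> real)"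
      unfolding F\<^sub>R_def case_prod_unfold
      by (intro continuous_intros fc Theta P.continuous_on) auto
  qed
  then show ?thesis by (auto simp: G\<^sub>R_def global_minimizers_def)
qed

text \<open>
  Scaling a short column keeps it short, where \<open>\<theta>\<^sub>\<nu>\<close> is linear, so that along this segment the
  concave penalty is affine in \<open>t\<close>.
\<close>

lemma scale_short_column:
  fixes X :: "real ^ 'd::finite ^ 'r"
  assumes X: "X \<in> Omega \<sigma>" and \<nu>: "0 < \<nu>" "\<nu> \<le> \<sigma>" and short: "norm (column i X) < \<nu>" and "e > 0"
  obtains r where "r > 0"
    "\<And>t. \<bar>t\<bar> \<le> r \<Longrightarrow> X + t *\<^sub>R cols {i} X \<in> Omega \<sigma>"
    "\<And>t. \<bar>t\<bar> \<le> r \<Longrightarrow> dist X (X + t *\<^sub>R cols {i} X) < e"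
    "\<And>t. \<bar>t\<bar> \<le> r \<Longrightarrow> Theta \<nu> (X + t *\<^sub>R cols {i} X) = Theta \<nu> X + t * (norm (column i X) / \<nu>)"
proof -
  let ?W = "\<lambda>t. X + t *\<^sub>R cols {i} X"
  have "\<forall>\<^sub>F t in at 0. (1 + t) * norm (column i X) < \<nu> \<and> dist X (?W t) < e \<and> \<bar>t\<bar> < 1"
  proof -
    have "((\<lambda>t. (1 + t) * norm (column i X)) \<longlongrightarrow> (1 + 0) * norm (column i X)) (at 0)"
      "((\<lambda>t. dist X (?W t)) \<longlongrightarrow> dist X (?W 0)) (at 0)"
      "((\<lambda>t::real. \<bar>t\<bar>) \<longlongrightarrow> \<bar>0\<bar>) (at 0)"
      by (intro tendsto_intros)+
    then show ?thesis
      using short \<open>e > 0\<close> by (auto intro!: eventually_conj order_tendstoD(2))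
  qed
  then obtain d where d: "d > 0" "\<And>t. t \<noteq> 0 \<Longrightarrow> \<bar>t\<bar> < d \<Longrightarrow>
      (1 + t) * norm (column i X) < \<nu> \<and> dist X (?W t) < e \<and> \<bar>t\<bar> < 1"
    by (auto simp: eventually_at dist_real_def)
  \<comment> \<open>The limit filter omits \<open>t = 0\<close>, where the estimates hold trivially.\<close>
  have small: "(1 + t) * norm (column i X) < \<nu> \<and> dist X (?W t) < e \<and> \<bar>t\<bar> < 1" if "\<bar>t\<bar> < d" for t
    using d(2)[of t] that short \<open>e > 0\<close> by (cases "t = 0") auto
  have col: "norm (column j (?W t)) = (if j = i then (1 + t) * norm (column j X) else norm (column j X))"
    if "\<bar>t\<bar> < d" for t j
  proof -
    have "column i X + t *\<^sub>R column i X = (1 + t) *\<^sub>R column i X" by (simp add: scaleR_add_left)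
    then show ?thesis using small[OF that] by (auto simp: column_simps)
  qed
  show thesis
  proof (rule that[of "d / 2"])
    show "d / 2 > 0" using d(1) by simp
    fix t :: real assume "\<bar>t\<bar> \<le> d / 2"
    then have t: "\<bar>t\<bar> < d" using d(1) by simp
    show "?W t \<in> Omega \<sigma>"
      using X small[OF t] \<nu> by (auto simp: Omega_def col[OF t])
    show "dist X (?W t) < e" using small[OF t] by blast
    have "theta \<nu> (norm (column j (?W t)))
        = theta \<nu> (norm (column j X)) + (if j = i then t * (norm (column i X) / \<nu>) else 0)" for j
      unfolding col[OF t] using \<nu>(1) small[OF t] short by (auto simp: theta_eq field_simps)
    then show "Theta \<nu> (?W t) = Theta \<nu> X + t * (norm (column i X) / \<nu>)"
      by (simp add: Theta_def sum.distrib)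
  qed
qed

text \<open>
  The Cauchy-Schwarz estimate that excludes short columns, both at local minimizers and at stationary
  points: to balance the slope \<open>l / \<nu>\<close> of the penalty, \<open>a\<close> would have to have norm at least
  \<open>l / \<nu>\<close>.
\<close>

lemma short_slope_contradiction:
  fixes a x :: "'a::real_inner"
  assumes "a \<bullet> x = - (l * (norm x / \<nu>))" "\<nu> > 0" "x \<noteq> 0" "\<nu> * norm a < l"
  shows False
proof -
  have "l * (norm x / \<nu>) \<le> norm a * norm x"
    using assms(1) Cauchy_Schwarz_ineq2[of a x] by linarith
  then have "l \<le> \<nu> * norm a" using assms(2,3) by (simp add: field_simps)
  with assms(4) show False by simp
qed

text \<open>
  The bound on the subgradients is only required at the point in question. It says that the loss is
  less steep, in each column, than the penalty on \<open>(0, \<nu>)\<close>; hence a short nonzero column could be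
  shrunk with profit.
\<close>

lemma local_minimizer_column_bound:
  fixes f :: "real ^ 'n ^ 'm \<Rightarrow> real"
    and X :: "real ^ 'd::finite ^ 'm" and Y :: "real ^ 'd ^ 'n"
  assumes f: "locally_lipschitz f" and \<nu>: "0 < \<nu>" "\<nu> \<le> \<sigma>"
    and slope: "\<And>H i. H \<in> limiting_subdiff f (X ** transpose Y) \<Longrightarrow>
      \<nu> * norm (H *v column i Y) < l \<and> \<nu> * norm (transpose H *v column i X) < l"
    and loc: "(X, Y) \<in> L\<^sub>R f l \<nu> \<sigma>"
  shows "column_bound \<nu> X Y"
proof -
  interpret P: bounded_bilinear "\<lambda>(X :: real ^ 'd ^ 'm) (Y :: real ^ 'd ^ 'n). X ** transpose Y"
    by (rule bounded_bilinear_mult_transpose)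
  from loc obtain e where XY: "X \<in> Omega \<sigma>" "Y \<in> Omega \<sigma>" and e: "e > 0"
    and min: "\<And>W V. W \<in> Omega \<sigma> \<Longrightarrow> V \<in> Omega \<sigma> \<Longrightarrow> dist (X, Y) (W, V) < e \<Longrightarrow>
        F\<^sub>R f l \<nu> (X, Y) \<le> F\<^sub>R f l \<nu> (W, V)"
    by (auto simp: L\<^sub>R_def local_minimizers_def feasible_def)
  have "norm (column i X) \<notin> {0<..<\<nu>}" for i
  proof
    assume i: "norm (column i X) \<in> {0<..<\<nu>}"
    let ?E = "cols {i} X"
    obtain r where r: "r > 0"
        "\<And>t. \<bar>t\<bar> \<le> r \<Longrightarrow> X + t *\<^sub>R ?E \<in> Omega \<sigma>"
        "\<And>t. \<bar>t\<bar> \<le> r \<Longrightarrow> dist X (X + t *\<^sub>R ?E) < e"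
        "\<And>t. \<bar>t\<bar> \<le> r \<Longrightarrow> Theta \<nu> (X + t *\<^sub>R ?E) = Theta \<nu> X + t * (norm (column i X) / \<nu>)"
      using scale_short_column[OF XY(1) \<nu> _ e] i by auto
    have "\<exists>H\<in>limiting_subdiff f (X ** transpose Y).
        H \<bullet> (?E ** transpose Y) = - (l * (norm (column i X) / \<nu>))"
    proof (rule segment_minimizer_multiplier[OF f r(1)])
      fix t :: real assume t: "\<bar>t\<bar> \<le> r"
      have "F\<^sub>R f l \<nu> (X, Y) \<le> F\<^sub>R f l \<nu> (X + t *\<^sub>R ?E, Y)"
        using min[OF r(2)[OF t] XY(2)] r(3)[OF t] by (simp add: dist_Pair_Pair)
      then show "f (X ** transpose Y)
          \<le> f (X ** transpose Y + t *\<^sub>R (?E ** transpose Y)) + t * (l * (norm (column i X) / \<nu>))"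
        by (simp add: F\<^sub>R_def r(4)[OF t] P.add_left P.scaleR_left algebra_simps)
    qed
    then obtain H where H: "H \<in> limiting_subdiff f (X ** transpose Y)"
        "(H *v column i Y) \<bullet> column i X = - (l * (norm (column i X) / \<nu>))"
      by (auto simp: inner_mult_transpose_left inner_cols_commute[symmetric] inner_cols_left column_simps)
    show False
      using short_slope_contradiction[OF H(2) \<nu>(1)] slope[OF H(1), of i] i by auto
  qed
  moreover have "norm (column i Y) \<notin> {0<..<\<nu>}" for i
  proof
    assume i: "norm (column i Y) \<in> {0<..<\<nu>}"
    let ?E = "cols {i} Y"
    obtain r where r: "r > 0"
        "\<And>t. \<bar>t\<bar> \<le> r \<Longrightarrow> Y + t *\<^sub>R ?E \<in> Omega \<sigma>"
        "\<And>t. \<bar>t\<bar> \<le> r \<Longrightarrow> dist Y (Y + t *\<^sub>R ?E) < e"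
        "\<And>t. \<bar>t\<bar> \<le> r \<Longrightarrow> Theta \<nu> (Y + t *\<^sub>R ?E) = Theta \<nu> Y + t * (norm (column i Y) / \<nu>)"
      using scale_short_column[OF XY(2) \<nu> _ e] i by auto
    have "\<exists>H\<in>limiting_subdiff f (X ** transpose Y).
        H \<bullet> (X ** transpose ?E) = - (l * (norm (column i Y) / \<nu>))"
    proof (rule segment_minimizer_multiplier[OF f r(1)])
      fix t :: real assume t: "\<bar>t\<bar> \<le> r"
      have "F\<^sub>R f l \<nu> (X, Y) \<le> F\<^sub>R f l \<nu> (X, Y + t *\<^sub>R ?E)"
        using min[OF XY(1) r(2)[OF t]] r(3)[OF t] by (simp add: dist_Pair_Pair)
      then show "f (X ** transpose Y)
          \<le> f (X ** transpose Y + t *\<^sub>R (X ** transpose ?E)) + t * (l * (norm (column i Y) / \<nu>))"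
        by (simp add: F\<^sub>R_def r(4)[OF t] P.add_right P.scaleR_right algebra_simps)
    qed
    then obtain H where H: "H \<in> limiting_subdiff f (X ** transpose Y)"
        "(transpose H *v column i X) \<bullet> column i Y = - (l * (norm (column i Y) / \<nu>))"
      by (auto simp: inner_mult_transpose_right inner_cols_commute[symmetric] inner_cols_left column_simps)
    show False
      using short_slope_contradiction[OF H(2) \<nu>(1)] slope[OF H(1), of i] i by auto
  qed
  ultimately show ?thesis unfolding column_bound_def by blast
qed

lemma global_minimizers_subset_local: "global_minimizers F S \<subseteq> local_minimizers F S"
  by (auto simp: global_minimizers_def local_minimizers_def intro: exI[of _ 1])

lemma optimal_value_global_minimizer:
  "p \<in> global_minimizers F S \<Longrightarrow> optimal_value F S = ereal (F p)"
  unfolding optimal_value_def global_minimizers_def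
  by (auto intro!: INF_eqI)

text \<open>
  A minorant that touches the objective at all of its own local minimizers can replace it:
  \<open>F p = F' p \<le> F' q \<le> F q\<close> for the competitors \<open>q\<close> of \<open>p\<close>. For the reverse inclusion of global
  minimizers one minimizer of the minorant is needed, since only it shows that the two optimal values
  agree.
\<close>

lemma tight_relaxation:
  assumes le: "\<And>p. p \<in> S \<Longrightarrow> F' p \<le> (F p :: real)"
    and eq: "\<And>p. p \<in> local_minimizers F' S \<Longrightarrow> F' p = F p"
  shows "local_minimizers F' S \<subseteq> local_minimizers F S"
    and "global_minimizers F' S \<noteq> {} \<Longrightarrow> global_minimizers F' S = global_minimizers F S"
    and "global_minimizers F' S \<noteq> {} \<Longrightarrow> optimal_value F S = optimal_value F' S"
proof -
  show "local_minimizers F' S \<subseteq> local_minimizers F S"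
  proof
    fix p assume p: "p \<in> local_minimizers F' S"
    then obtain e where e: "e > 0" "p \<in> S" "\<And>q. q \<in> S \<inter> ball p e \<Longrightarrow> F' p \<le> F' q"
      by (auto simp: local_minimizers_def)
    have "F p \<le> F q" if "q \<in> S \<inter> ball p e" for q
      using eq[OF p] e(3)[OF that] le[of q] that by auto
    with e(1,2) show "p \<in> local_minimizers F S" unfolding local_minimizers_def by blast
  qed
  have eqg: "F' p = F p" if "p \<in> global_minimizers F' S" for p
    using eq global_minimizers_subset_local that by blast
  have sub: "p \<in> global_minimizers F S" if p: "p \<in> global_minimizers F' S" for p
    using eqg[OF p] p le by (force simp: global_minimizers_def)
  assume "global_minimizers F' S \<noteq> {}"
  then obtain p where p: "p \<in> global_minimizers F' S" by blast
  show "optimal_value F S = optimal_value F' S"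
    using optimal_value_global_minimizer[OF p] optimal_value_global_minimizer[OF sub[OF p]] eqg[OF p]
    by simp
  have "q \<in> global_minimizers F' S" if "q \<in> global_minimizers F S" for q
    using that p le[of q] eqg[OF p] by (force simp: global_minimizers_def)
  with sub show "global_minimizers F' S = global_minimizers F S" by blast
qed

section \<open>Global minimizers of the column-count problem\<close>

text \<open>
  Deleting the columns outside the common support leaves the product unchanged and strictly lowers
  the count unless both supports equal the common one.
\<close>

lemma global_minimizer_column_consistent:
  fixes f :: "real ^ 'n ^ 'm \<Rightarrow> real"
    and X :: "real ^ 'd::finite ^ 'm" and Y :: "real ^ 'd ^ 'n"
  assumes "l > 0" and glob: "(X, Y) \<in> G\<^sub>0 f l \<sigma>"
  shows "column_consistent X Y"
proof -
  define J where "J = nz_cols X \<inter> nz_cols Y"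
  have "F\<^sub>0 f l (X, Y) \<le> F\<^sub>0 f l (cols J X, cols J Y)"
    using glob by (auto simp: G\<^sub>0_def global_minimizers_def feasible_def cols_Omega)
  moreover have "cols J X ** transpose (cols J Y) = X ** transpose Y"
    by (rule mult_transpose_columns_cong) (auto simp: column_simps J_def nz_cols_def)
  ultimately have "real (nnzc X) + real (nnzc Y) \<le> real (nnzc (cols J X)) + real (nnzc (cols J Y))"
    using \<open>l > 0\<close> by (simp add: F\<^sub>0_def)
  moreover have "nz_cols (cols J X) = J" "nz_cols (cols J Y) = J"
    by (auto simp: nz_cols_cols J_def)
  ultimately have "card (nz_cols X) + card (nz_cols Y) \<le> card J + card J"
    by (simp add: nnzc_def flip: of_nat_add)
  moreover have "card J \<le> card (nz_cols X)" "card J \<le> card (nz_cols Y)"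
    by (auto intro!: card_mono simp: J_def)
  ultimately have "card J = card (nz_cols X)" "card J = card (nz_cols Y)" by simp_all
  then have "J = nz_cols X" "J = nz_cols Y"
    by (simp_all add: card_subset_eq J_def)
  then show ?thesis by (simp add: column_consistent_def)
qed

text \<open>
  On matrices supported on \<open>J\<close> the column counts cannot exceed those of the minimizer, so there the
  minimizer also minimizes the loss alone. This set is convex, and it is the set to whose normal cone
  the stationarity condition refers.
\<close>

lemma global_minimizer_stationary:
  fixes f :: "real ^ 'n ^ 'm \<Rightarrow> real"
    and X :: "real ^ 'd::finite ^ 'm" and Y :: "real ^ 'd ^ 'n"
  assumes f: "locally_lipschitz f" and l: "l > 0" and glob: "(X, Y) \<in> G\<^sub>0 f l \<sigma>"
  shows "(X, Y) \<in> stationary\<^sub>0 f \<sigma>"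
proof -
  interpret P: bounded_bilinear "\<lambda>(X :: real ^ 'd ^ 'm) (Y :: real ^ 'd ^ 'n). X ** transpose Y"
    by (rule bounded_bilinear_mult_transpose)
  have XY: "X \<in> Omega \<sigma>" "Y \<in> Omega \<sigma>"
    using glob by (auto simp: G\<^sub>0_def global_minimizers_def feasible_def)
  have min: "F\<^sub>0 f l (X, Y) \<le> F\<^sub>0 f l (W, V)" if "W \<in> Omega \<sigma>" "V \<in> Omega \<sigma>"
    for W :: "real ^ 'd ^ 'm" and V :: "real ^ 'd ^ 'n"
    using glob that unfolding G\<^sub>0_def global_minimizers_def feasible_def by blast
  define J where "J = nz_cols X"
  have J: "nz_cols Y = J"
    using global_minimizer_column_consistent[OF l glob] by (simp add: column_consistent_def J_def)
  have colsX: "cols J X = X" and colsY: "cols J Y = Y"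
    by (simp_all add: cols_nz_cols J J_def)
  let ?A = "cols J ` (Omega \<sigma> :: (real ^ 'd ^ 'm) set)"
  let ?B = "cols J ` (Omega \<sigma> :: (real ^ 'd ^ 'n) set)"
  have XA: "X \<in> ?A" and YB: "Y \<in> ?B"
    using XY colsX colsY by (metis imageI)+
  have fmin: "f (X ** transpose Y) \<le> f (W ** transpose V)" if "W \<in> ?A" "V \<in> ?B" for W V
  proof -
    have "nz_cols W \<subseteq> J" "nz_cols V \<subseteq> J"
      using that by (auto simp: nz_cols_cols)
    then have "nnzc W \<le> nnzc X" "nnzc V \<le> nnzc Y"
      unfolding nnzc_def J J_def[symmetric] by (auto intro!: card_mono)
    then have "l * (real (nnzc W) + real (nnzc V)) \<le> l * (real (nnzc X) + real (nnzc Y))"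
      using l by (intro mult_left_mono) auto
    moreover have "F\<^sub>0 f l (X, Y) \<le> F\<^sub>0 f l (W, V)"
      using that by (intro min) (auto simp: cols_Omega)
    ultimately show ?thesis by (simp add: F\<^sub>0_def)
  qed
  let ?g = "\<lambda>p :: (real ^ 'd ^ 'm) \<times> (real ^ 'd ^ 'n). fst p ** transpose (snd p)"
  let ?g' = "\<lambda>(p :: (real ^ 'd ^ 'm) \<times> (real ^ 'd ^ 'n)) h.
      fst p ** transpose (snd h) + fst h ** transpose (snd p)"
  have "\<exists>H\<in>limiting_subdiff f (?g (X, Y)).
      \<forall>w\<in>?A \<times> ?B. 0 \<le> H \<bullet> ?g' (X, Y) (w - (X, Y)) + 0 \<bullet> (w - (X, Y))"
  proof (rule composite_minimizer_multiplier[OF f, where g = ?g and g' = ?g'])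
    show "compact (?A \<times> ?B)"
      by (intro compact_Times compact_continuous_image linear_continuous_on
          linear_conv_bounded_linear[THEN iffD1] linear_cols compact_Omega)
    show "convex (?A \<times> ?B)"
      by (intro convex_Times convex_linear_image linear_cols convex_Omega)
    show "((\<lambda>p. fst p ** transpose (snd p)) has_derivative
        (\<lambda>h. fst u ** transpose (snd h) + fst h ** transpose (snd u))) (at u within ?A \<times> ?B)" for u
      by (intro P.FDERIV has_derivative_fst has_derivative_snd has_derivative_ident)
    show "isCont (\<lambda>(u, w). fst u ** transpose (snd w) + fst w ** transpose (snd u)) ((X, Y), v)" for v
      unfolding case_prod_unfold by (intro continuous_intros P.isCont)
  qed (use XA YB fmin in auto)
  then obtain H where H: "H \<in> limiting_subdiff f (X ** transpose Y)"
    and Hw: "\<And>W V. W \<in> ?A \<Longrightarrow> V \<in> ?B \<Longrightarrow>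
        0 \<le> H \<bullet> (X ** transpose (V - Y)) + H \<bullet> ((W - X) ** transpose Y)"
    by (force simp: inner_add_right)
  \<comment> \<open>Freezing one factor at a time separates the joint inequality.\<close>
  have "- (H ** cols J Y) \<in> normal_cone_in (range (cols J)) ?A (cols J X)"
    unfolding normal_cone_in_def
  proof (intro CollectI conjI ballI)
    show "- (H ** cols J Y) \<in> range (cols J)"
      by (simp add: matrix_mult_cols flip: cols_uminus)
    show "- (H ** cols J Y) \<bullet> (W - cols J X) \<le> 0" if "W \<in> ?A" for W
      using Hw[OF that YB] by (simp add: colsX colsY P.zero_right inner_mult_transpose_left)
  qed (use XA colsX in simp)
  moreover have "- (transpose H ** cols J X) \<in> normal_cone_in (range (cols J)) ?B (cols J Y)"
    unfolding normal_cone_in_def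
  proof (intro CollectI conjI ballI)
    show "- (transpose H ** cols J X) \<in> range (cols J)"
      by (simp add: matrix_mult_cols flip: cols_uminus)
    show "- (transpose H ** cols J X) \<bullet> (V - cols J Y) \<le> 0" if "V \<in> ?B" for V
      using Hw[OF XA that] by (simp add: colsX colsY P.zero_left inner_mult_transpose_right)
  qed (use YB colsY in simp)
  ultimately show ?thesis
    using XY H unfolding stationary\<^sub>0_def feasible_def
    by (auto simp: J J_def[symmetric] Let_def intro!: bexI[of _ H] exI)
qed

section \<open>Stationary points of the two problems\<close>

text \<open>
  At the kink \<open>\<nu>\<close> both pieces attain the minimum and the maximum selects the constant one, so columns
  of norm exactly \<open>\<nu>\<close> count as long.
\<close>

lemma D_index_eq:
  assumes "\<nu> > 0"
  shows "D_index \<nu> C i = (if norm (column i C) < \<nu> then 1 else 2)"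
proof -
  let ?t = "norm (column i C)"
  have "{j \<in> {1, 2}. theta_piece \<nu> j ?t = theta \<nu> ?t}
      = (if ?t < \<nu> then {1} else if ?t = \<nu> then {1, 2} else {2})"
    using assms by (auto simp: theta_eq theta_piece_def)
  then show ?thesis by (simp add: D_index_def)
qed

lemma Theta_piece_add_column:
  fixes Z E :: "real ^ 'd::finite ^ 'r"
  assumes E: "\<And>j. j \<noteq> i \<Longrightarrow> column j E = 0"
    and i: "theta_piece \<nu> (I i) (norm (column i (Z + E))) = theta_piece \<nu> (I i) (norm (column i Z)) + a"
  shows "Theta_piece \<nu> I (Z + E) = Theta_piece \<nu> I Z + a"
proof -
  have "theta_piece \<nu> (I j) (norm (column j (Z + E)))
      = theta_piece \<nu> (I j) (norm (column j Z)) + (if j = i then a else 0)" for j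
    using assms by (auto simp: column_simps)
  then show ?thesis by (simp add: Theta_piece_def sum.distrib)
qed

lemma limiting_subdiff_Theta_piece_flat:
  fixes X U :: "real ^ 'd::finite ^ 'r"
  assumes U: "U \<in> limiting_subdiff (Theta_piece \<nu> I) X" and i: "I i \<noteq> 1"
  shows "column i U = 0"
proof -
  have "U \<bullet> cols {i} U = 0"
    by (rule limiting_subdiff_affine_lines[OF U, where E = "\<lambda>_. cols {i} U" and a = "\<lambda>_. 0"])
      (use i in \<open>auto intro!: Theta_piece_add_column[where a = 0, simplified]
        simp: column_simps theta_piece_def\<close>)
  then show ?thesis by (simp add: inner_cols_left flip: inner_cols_commute)
qed

text \<open>
  Only the radial component of the gradient of \<open>\<parallel>\<cdot>\<parallel> / \<nu>\<close> is recorded: it is what the slope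
  estimate uses, and it can be read off from scalings of the column.
\<close>

lemma limiting_subdiff_Theta_piece_radial:
  fixes X U :: "real ^ 'd::finite ^ 'r"
  assumes U: "U \<in> limiting_subdiff (Theta_piece \<nu> I) X" and i: "I i = 1"
  shows "column i U \<bullet> column i X = norm (column i X) / \<nu>"
proof -
  have "U \<bullet> cols {i} X = norm (column i X) / \<nu>"
  proof (rule limiting_subdiff_affine_lines[OF U, where E = "cols {i}" and a = "\<lambda>Z. norm (column i Z) / \<nu>"])
    fix Z :: "real ^ 'd ^ 'r" and t :: real assume t: "\<bar>t\<bar> \<le> 1"
    have "column i (Z + t *\<^sub>R cols {i} Z) = (1 + t) *\<^sub>R column i Z"
      by (simp add: column_simps scaleR_add_left)
    with t have "norm (column i (Z + t *\<^sub>R cols {i} Z)) = (1 + t) * norm (column i Z)"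
      by simp
    then show "Theta_piece \<nu> I (Z + t *\<^sub>R cols {i} Z) = Theta_piece \<nu> I Z + t * (norm (column i Z) / \<nu>)"
      by (intro Theta_piece_add_column)
        (auto simp: column_simps i theta_piece_def add_divide_distrib distrib_right)
  next
    show "isCont (cols {i}) X"
      by (rule linear_continuous_at) (simp add: linear_cols linear_conv_bounded_linear[symmetric])
    have "continuous_on UNIV (\<lambda>Z :: real ^ 'd ^ 'r. norm (column i Z) / \<nu>)"
      unfolding column_def divide_inverse by (intro continuous_intros)
    then show "isCont (\<lambda>Z. norm (column i Z) / \<nu>) X"
      by (simp add: continuous_on_eq_continuous_at)
  qed
  then show ?thesis by (simp add: inner_cols_left flip: inner_cols_commute)
qed

text \<open>
  Without short columns every selected piece is at its minimum: it is constant, or it is a multiple of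
  the norm of a zero column.
\<close>

lemma zero_in_limiting_subdiff_Theta_piece:
  fixes X :: "real ^ 'd::finite ^ 'r"
  assumes \<nu>: "\<nu> > 0" and X: "\<And>i. norm (column i X) \<notin> {0<..<\<nu>}"
  shows "0 \<in> limiting_subdiff (Theta_piece \<nu> (D_index \<nu> X)) X"
proof -
  have "Theta_piece \<nu> (D_index \<nu> X) X \<le> Theta_piece \<nu> (D_index \<nu> X) Z"
    for Z :: "real ^ 'd ^ 'r"
    unfolding Theta_piece_def
  proof (rule sum_mono)
    fix i
    show "theta_piece \<nu> (D_index \<nu> X i) (norm (column i X))
        \<le> theta_piece \<nu> (D_index \<nu> X i) (norm (column i Z))"
      using \<nu> X[of i] by (auto simp: D_index_eq theta_piece_def)
  qed
  then have "0 \<in> regular_subdiff (Theta_piece \<nu> (D_index \<nu> X)) X"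
    by (intro proximal_imp_regular_subdiff[where C = 0] always_eventually) simp
  then show ?thesis using regular_subdiff_subset_limiting by blast
qed

text \<open>
  A column in the interior of its ball can be scaled in both directions within \<open>\<Omega>\<close>.
\<close>

lemma normal_cone_Omega_short_column:
  fixes X V :: "real ^ 'd::finite ^ 'r"
  assumes V: "V \<in> normal_cone (Omega \<sigma>) X" and short: "norm (column i X) < \<sigma>"
  shows "column i V \<bullet> column i X = 0"
proof -
  have X: "X \<in> Omega \<sigma>" and le: "\<And>W. W \<in> Omega \<sigma> \<Longrightarrow> V \<bullet> (W - X) \<le> 0"
    using V by (auto simp: normal_cone_in_def)
  have \<sigma>: "0 < \<sigma>" by (rule le_less_trans[OF norm_ge_zero short])
  \<comment> \<open>The radius \<open>\<sigma>\<close> serves as the threshold of shortness, so that scaled columns stay feasible.\<close>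
  obtain r where r: "r > 0" "\<And>t. \<bar>t\<bar> \<le> r \<Longrightarrow> X + t *\<^sub>R cols {i} X \<in> Omega \<sigma>"
    by (rule scale_short_column[OF X \<sigma> order_refl short zero_less_one]) (rule that)
  have "r * (V \<bullet> cols {i} X) \<le> 0" "0 \<le> r * (V \<bullet> cols {i} X)"
    using le[OF r(2)[of r]] le[OF r(2)[of "-r"]] r(1) by simp_all
  then have "V \<bullet> cols {i} X = 0" using r(1) by (simp add: mult_le_0_iff zero_le_mult_iff)
  then show ?thesis by (simp add: inner_cols_left flip: inner_cols_commute)
qed

text \<open>
  Here \<open>G\<close> stands for \<open>H Y\<close> or \<open>H\<^sup>T X\<close>, so that one statement covers both factors. In the
  columns of \<open>J\<close> the penalty contributes nothing, because a short column would violate the slope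
  bound; and normal vectors of \<open>\<Omega>\<close> restrict to normal vectors of its projection, since the columns
  outside \<open>J\<close> can be kept fixed.
\<close>

lemma stationary_factor_R_imp_0:
  fixes X G U V :: "real ^ 'd::finite ^ 'r"
  assumes \<nu>: "0 < \<nu>" "\<nu> \<le> \<sigma>"
    and slope: "\<And>i. \<nu> * norm (column i G) < l"
    and sum: "0 = G + l *\<^sub>R U + V"
    and U: "U \<in> limiting_subdiff (Theta_piece \<nu> (D_index \<nu> X)) X"
    and V: "V \<in> normal_cone (Omega \<sigma>) X"
    and J: "J \<subseteq> nz_cols X"
  shows "- cols J G \<in> normal_cone_in (range (cols J)) (cols J ` Omega \<sigma>) (cols J X)"
proof -
  have X: "X \<in> Omega \<sigma>" and le: "\<And>W. W \<in> Omega \<sigma> \<Longrightarrow> V \<bullet> (W - X) \<le> 0"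
    using V by (auto simp: normal_cone_in_def)
  have col: "column i G + l *\<^sub>R column i U + column i V = 0" for i
    using arg_cong[OF sum, of "column i"] by (simp add: column_simps)
  have long: "\<nu> \<le> norm (column i X)" if "i \<in> J" for i
  proof (rule ccontr)
    assume short: "\<not> \<nu> \<le> norm (column i X)"
    then have "column i U \<bullet> column i X = norm (column i X) / \<nu>"
      by (intro limiting_subdiff_Theta_piece_radial[OF U]) (simp add: D_index_eq \<nu>)
    moreover have "column i V \<bullet> column i X = 0"
      using short \<nu> by (intro normal_cone_Omega_short_column[OF V]) simp
    ultimately have "column i G \<bullet> column i X = - (l * (norm (column i X) / \<nu>))"
      using arg_cong[OF col[of i], of "\<lambda>v. v \<bullet> column i X"] by (simp add: inner_add_left)
    moreover have "column i X \<noteq> 0"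
      using J that by (auto simp: nz_cols_def)
    ultimately show False
      using short_slope_contradiction \<nu>(1) slope by blast
  qed
  have "cols J V = - cols J G"
  proof (rule matrix_eq_columnI)
    fix i
    have "column i G + column i V = 0" if "i \<in> J"
      using col[of i] limiting_subdiff_Theta_piece_flat[OF U, of i] long[OF that]
      by (simp add: D_index_eq \<nu>)
    then show "column i (cols J V) = column i (- cols J G)"
      by (simp add: column_simps add_eq_0_iff)
  qed
  moreover have "cols J V \<in> normal_cone_in (range (cols J)) (cols J ` Omega \<sigma>) (cols J X)"
    unfolding normal_cone_in_def
  proof (intro CollectI conjI ballI)
    fix W' :: "real ^ 'd ^ 'r"
    assume "W' \<in> cols J ` Omega \<sigma>"
    then obtain W where W: "W \<in> Omega \<sigma>" "W' = cols J W" by blast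
    have "X + cols J (W - X) \<in> Omega \<sigma>"
      using X W(1) by (auto simp: Omega_def column_simps)
    from le[OF this] have "V \<bullet> cols J (W - X) \<le> 0" by simp
    moreover have "W' - cols J X = cols J (W - X)"
      by (rule matrix_eq_columnI) (simp add: W column_simps)
    ultimately show "cols J V \<bullet> (W' - cols J X) \<le> 0"
      by (simp add: inner_cols_commute cols_idem)
  qed (use X in auto)
  ultimately show ?thesis by simp
qed

text \<open>
  If \<open>G\<close> is supported on \<open>J\<close>, pairing it with a matrix sees only the columns of \<open>J\<close>.
\<close>

lemma stationary_factor_0_imp_R:
  fixes X G :: "real ^ 'd::finite ^ 'r"
  assumes N: "- cols J G \<in> normal_cone_in (range (cols J)) (cols J ` Omega \<sigma>) (cols J X)"
    and X: "X \<in> Omega \<sigma>" and J: "nz_cols X \<subseteq> J" "nz_cols G \<subseteq> J"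
  shows "- G \<in> normal_cone (Omega \<sigma>) X"
proof -
  have "- G \<bullet> (W - X) \<le> 0" if "W \<in> Omega \<sigma>" for W
  proof -
    have "- G \<bullet> (cols J W - X) \<le> 0"
      using N that by (auto simp: normal_cone_in_def cols_nz_cols J)
    moreover have "G \<bullet> cols J W = G \<bullet> W"
      by (simp add: cols_nz_cols J flip: inner_cols_commute)
    ultimately show ?thesis by (simp add: inner_diff_right)
  qed
  with X show ?thesis by (simp add: normal_cone_in_def)
qed

lemma zero_in_translate: "0 \<in> {A + V | V. V \<in> N} \<longleftrightarrow> - A \<in> N"
  for A :: "'a::group_add"
  by (auto simp: eq_neg_iff_add_eq_0[symmetric] dest: minus_unique intro!: exI[of _ "-A"])

lemma zero_in_sum_of_sets:
  fixes A :: "'a::real_vector"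
  assumes "0 \<in> D" "- A \<in> N"
  shows "0 \<in> {A + l *\<^sub>R U + V | U V. U \<in> D \<and> V \<in> N}"
proof -
  have "0 = A + l *\<^sub>R 0 + (- A)" by simp
  with assms show ?thesis by blast
qed

lemma stationary\<^sub>R_imp_stationary\<^sub>0:
  fixes f :: "real ^ 'n ^ 'm \<Rightarrow> real"
    and X :: "real ^ 'd::finite ^ 'm" and Y :: "real ^ 'd ^ 'n"
  assumes \<nu>: "0 < \<nu>" "\<nu> \<le> \<sigma>"
    and slope: "\<And>H i. H \<in> limiting_subdiff f (X ** transpose Y) \<Longrightarrow>
      \<nu> * norm (H *v column i Y) < l \<and> \<nu> * norm (transpose H *v column i X) < l"
    and st: "(X, Y) \<in> stationary\<^sub>R f l \<nu> \<sigma>"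
  shows "(X, Y) \<in> stationary\<^sub>0 f \<sigma>"
proof -
  obtain H U V U' V' where XY: "(X, Y) \<in> feasible \<sigma>"
    and H: "H \<in> limiting_subdiff f (X ** transpose Y)"
    and 1: "0 = H ** Y + l *\<^sub>R U + V" "U \<in> limiting_subdiff (Theta_piece \<nu> (D_index \<nu> X)) X"
      "V \<in> normal_cone (Omega \<sigma>) X"
    and 2: "0 = transpose H ** X + l *\<^sub>R U' + V'" "U' \<in> limiting_subdiff (Theta_piece \<nu> (D_index \<nu> Y)) Y"
      "V' \<in> normal_cone (Omega \<sigma>) Y"
    using st unfolding stationary\<^sub>R_def by blast
  define J where "J = nz_cols X \<inter> nz_cols Y"
  have "- cols J (H ** Y) \<in> normal_cone_in (range (cols J)) (cols J ` Omega \<sigma>) (cols J X)"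
    by (rule stationary_factor_R_imp_0[OF \<nu> _ 1]) (use slope[OF H] in \<open>auto simp: column_simps J_def\<close>)
  moreover have "- cols J (transpose H ** X) \<in> normal_cone_in (range (cols J)) (cols J ` Omega \<sigma>) (cols J Y)"
    by (rule stationary_factor_R_imp_0[OF \<nu> _ 2]) (use slope[OF H] in \<open>auto simp: column_simps J_def\<close>)
  ultimately show ?thesis
    using XY H unfolding stationary\<^sub>0_def Let_def zero_in_translate J_def[symmetric]
    by (auto simp: matrix_mult_cols J_def[symmetric])
qed

lemma stationary\<^sub>0_imp_stationary\<^sub>R:
  fixes f :: "real ^ 'n ^ 'm \<Rightarrow> real"
    and X :: "real ^ 'd::finite ^ 'm" and Y :: "real ^ 'd ^ 'n"
  assumes \<nu>: "0 < \<nu>"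
    and st: "(X, Y) \<in> stationary\<^sub>0 f \<sigma>"
    and cc: "column_consistent X Y" and cb: "column_bound \<nu> X Y"
  shows "(X, Y) \<in> stationary\<^sub>R f l \<nu> \<sigma>"
proof -
  define J where "J = nz_cols X"
  have J: "nz_cols Y = J" using cc by (simp add: column_consistent_def J_def)
  obtain H where XY: "(X, Y) \<in> feasible \<sigma>"
    and H: "H \<in> limiting_subdiff f (X ** transpose Y)"
    and 1: "- cols J (H ** Y) \<in> normal_cone_in (range (cols J)) (cols J ` Omega \<sigma>) (cols J X)"
    and 2: "- cols J (transpose H ** X) \<in> normal_cone_in (range (cols J)) (cols J ` Omega \<sigma>) (cols J Y)"
    using st unfolding stationary\<^sub>0_def Let_def zero_in_translate
    by (auto simp: matrix_mult_cols J J_def[symmetric])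
  have "- (H ** Y) \<in> normal_cone (Omega \<sigma>) X"
    by (rule stationary_factor_0_imp_R[OF 1])
      (use XY nz_cols_mult[of H Y] in \<open>auto simp: feasible_def J J_def\<close>)
  moreover have "- (transpose H ** X) \<in> normal_cone (Omega \<sigma>) Y"
    by (rule stationary_factor_0_imp_R[OF 2])
      (use XY nz_cols_mult[of "transpose H" X] in \<open>auto simp: feasible_def J J_def\<close>)
  moreover have "0 \<in> limiting_subdiff (Theta_piece \<nu> (D_index \<nu> X)) X"
    "0 \<in> limiting_subdiff (Theta_piece \<nu> (D_index \<nu> Y)) Y"
    using \<nu> cb by (auto intro!: zero_in_limiting_subdiff_Theta_piece simp: column_bound_def)
  ultimately show ?thesis
    using XY H unfolding stationary\<^sub>R_def
    by (intro CollectI[of "case_prod _"] case_prodI conjI bexI[of _ H] zero_in_sum_of_sets)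
qed

section \<open>Equivalence of the two problems\<close>

theorem theorem8:
  fixes f :: "real ^ 'n ^ 'm \<Rightarrow> real"
    and l \<sigma> \<kappa> \<nu> :: real
  assumes dims: "CARD('n::finite) \<le> CARD('m::finite)"
    and l_pos: "l > 0"
    and sigma_pos: "\<sigma> > 0"
    and f_lip: "locally_lipschitz f"
    and kappa_pos: "\<kappa> > 0"
    and kappa_bound: "\<And>(X :: real ^ 'd ^ 'm) (Y :: real ^ 'd ^ 'n) H i.
          X \<in> Omega \<sigma> \<Longrightarrow> Y \<in> Omega \<sigma> \<Longrightarrow> H \<in> limiting_subdiff f (X ** transpose Y) \<Longrightarrow>
          max (norm (H *v column i Y)) (norm (transpose H *v column i X)) \<le> \<kappa>"
    and nu_range: "\<nu> \<in> {0<..<min (l / \<kappa>) \<sigma>}"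
  shows
    "((G\<^sub>R f l \<nu> \<sigma> :: ('m, 'n, 'd::finite) factors set) = G\<^sub>0 f l \<sigma> \<and>
      (L\<^sub>R f l \<nu> \<sigma> :: ('m, 'n, 'd) factors set) \<subseteq> L\<^sub>0 f l \<sigma> \<and>
      optimal_value (F\<^sub>0 f l) (feasible \<sigma> :: ('m, 'n, 'd) factors set) =
      optimal_value (F\<^sub>R f l \<nu>) (feasible \<sigma> :: ('m, 'n, 'd) factors set)) \<and>
     (\<forall>(X :: real ^ 'd ^ 'm, Y :: real ^ 'd ^ 'n) \<in> G\<^sub>0 f l \<sigma> \<union> G\<^sub>R f l \<nu> \<sigma>.
        column_consistent X Y \<and> column_bound \<nu> X Y) \<and>
     ((G\<^sub>0 f l \<sigma> :: ('m, 'n, 'd) factors set) \<subseteq> strong_stationary\<^sub>0 f \<nu> \<sigma> \<and>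
      (G\<^sub>R f l \<nu> \<sigma> :: ('m, 'n, 'd) factors set) \<subseteq> strong_stationary\<^sub>R f l \<nu> \<sigma> \<and>
      (strong_stationary\<^sub>0 f \<nu> \<sigma> :: ('m, 'n, 'd) factors set) = strong_stationary\<^sub>R f l \<nu> \<sigma> \<and>
      (strong_stationary\<^sub>R f l \<nu> \<sigma> :: ('m, 'n, 'd) factors set) \<subseteq> stationary\<^sub>R f l \<nu> \<sigma> \<and>
      (stationary\<^sub>R f l \<nu> \<sigma> :: ('m, 'n, 'd) factors set) \<subseteq> stationary\<^sub>0 f \<sigma>)"
proof -
  have \<nu>: "0 < \<nu>" "\<nu> \<le> \<sigma>" and \<nu>\<kappa>: "\<nu> * \<kappa> < l"
    using nu_range kappa_pos by (auto simp: field_simps)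
  have slope: "\<nu> * norm (H *v column i Y) < l \<and> \<nu> * norm (transpose H *v column i X) < l"
    if "(X, Y) \<in> feasible \<sigma>" "H \<in> limiting_subdiff f (X ** transpose Y)"
    for X :: "real ^ 'd ^ 'm" and Y :: "real ^ 'd ^ 'n" and H i
  proof -
    have "norm (H *v column i Y) \<le> \<kappa>" "norm (transpose H *v column i X) \<le> \<kappa>"
      using kappa_bound[of X Y H i] that by (auto simp: feasible_def)
    then have "\<nu> * norm (H *v column i Y) \<le> \<nu> * \<kappa>" "\<nu> * norm (transpose H *v column i X) \<le> \<nu> * \<kappa>"
      using \<nu>(1) by (auto intro: mult_left_mono)
    with \<nu>\<kappa> show ?thesis by linarith
  qed
  have bound: "column_bound \<nu> X Y" if "(X, Y) \<in> L\<^sub>R f l \<nu> \<sigma>"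
    for X :: "real ^ 'd ^ 'm" and Y :: "real ^ 'd ^ 'n"
    by (rule local_minimizer_column_bound[OF f_lip \<nu> slope that])
      (use that in \<open>auto simp: L\<^sub>R_def local_minimizers_def\<close>)
  note tight = tight_relaxation[of "feasible \<sigma> :: ('m, 'n, 'd) factors set" "F\<^sub>R f l \<nu>" "F\<^sub>0 f l",
      folded G\<^sub>R_def G\<^sub>0_def L\<^sub>R_def L\<^sub>0_def, OF F\<^sub>R_le_F\<^sub>0[OF l_pos \<nu>(1)]]
  have FRF0: "F\<^sub>R f l \<nu> p = F\<^sub>0 f l p" if "p \<in> L\<^sub>R f l \<nu> \<sigma>" for p :: "('m, 'n, 'd) factors"
    using that bound F\<^sub>R_eq_F\<^sub>0[OF \<nu>(1)] by (cases p) blast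
  have GR: "(G\<^sub>R f l \<nu> \<sigma> :: ('m, 'n, 'd) factors set) \<noteq> {}"
    by (rule F\<^sub>R_minimizer_exists[OF f_lip]) (use sigma_pos in simp)
  have G: "(G\<^sub>R f l \<nu> \<sigma> :: ('m, 'n, 'd) factors set) = G\<^sub>0 f l \<sigma>"
    by (rule tight(2)[OF FRF0 GR])
  have i: "(L\<^sub>R f l \<nu> \<sigma> :: ('m, 'n, 'd) factors set) \<subseteq> L\<^sub>0 f l \<sigma>"
      "optimal_value (F\<^sub>0 f l) (feasible \<sigma> :: ('m, 'n, 'd) factors set) =
       optimal_value (F\<^sub>R f l \<nu>) (feasible \<sigma> :: ('m, 'n, 'd) factors set)"
    by (rule tight(1)[OF FRF0], assumption) (rule tight(3)[OF FRF0 GR])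
  have ii: "column_consistent X Y" "column_bound \<nu> X Y" if "(X, Y) \<in> G\<^sub>0 f l \<sigma>"
    for X :: "real ^ 'd ^ 'm" and Y :: "real ^ 'd ^ 'n"
    using global_minimizer_column_consistent[OF l_pos that] that G
      bound global_minimizers_subset_local unfolding G\<^sub>R_def L\<^sub>R_def by blast+
  have G0S: "(G\<^sub>0 f l \<sigma> :: ('m, 'n, 'd) factors set) \<subseteq> strong_stationary\<^sub>0 f \<nu> \<sigma>"
    using global_minimizer_stationary[OF f_lip l_pos] ii by (auto simp: strong_stationary\<^sub>0_def)
  have SR0: "(stationary\<^sub>R f l \<nu> \<sigma> :: ('m, 'n, 'd) factors set) \<subseteq> stationary\<^sub>0 f \<sigma>"
  proof clarify
    fix X :: "real ^ 'd ^ 'm" and Y :: "real ^ 'd ^ 'n"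
    assume st: "(X, Y) \<in> stationary\<^sub>R f l \<nu> \<sigma>"
    then have "(X, Y) \<in> feasible \<sigma>" by (simp add: stationary\<^sub>R_def)
    from stationary\<^sub>R_imp_stationary\<^sub>0[OF \<nu> slope[OF this] st]
    show "(X, Y) \<in> stationary\<^sub>0 f \<sigma>" .
  qed
  have SS: "(strong_stationary\<^sub>0 f \<nu> \<sigma> :: ('m, 'n, 'd) factors set) = strong_stationary\<^sub>R f l \<nu> \<sigma>"
    using SR0 stationary\<^sub>0_imp_stationary\<^sub>R[OF \<nu>(1)]
    by (auto simp: strong_stationary\<^sub>0_def strong_stationary\<^sub>R_def)
  have "(strong_stationary\<^sub>R f l \<nu> \<sigma> :: ('m, 'n, 'd) factors set) \<subseteq> stationary\<^sub>R f l \<nu> \<sigma>"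
    by (auto simp: strong_stationary\<^sub>R_def)
  then show ?thesis
    using G i ii G0S SR0 SS by auto
qed

end
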